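(* Let $\nu\ge1$ and $H=d_\nu$, $m=2\nu$. If $n$ is large enough, the logarithmic energy function $F=\log T_w$ has a "saddle point" at the set $Z$ of zeros of the orthogonal polynomial $P_{m,m+n}$ with respect to $w$; more precisely, there is a constant $K(m)>0$ independent of $n$ such that for all sufficiently large $n$ the modified Hessian $\mathbf{\hat H}=D^{-1}\mathbf{H}(Z)D$ formed with this constant is diagonally dominant, $h_{2m+i,2m+i}<0$ for $i=1,\dots,n$, and $h_{2l-1,2l-1}=-h_{2l,2l}<0$ for $l=1,\dots,m$.
   Context: Let $\{h_j\}_{j\ge0}$ be the orthonormal Hermite polynomials (with respect to $e^{-x^2}$ on $\mathbb{R}$, positive leading coefficients) and $$d_\nu=\begin{vmatrix} h_\nu & h_{\nu+1} \\ h_\nu' & h_{\nu+1}' \end{vmatrix},$$ an even real polynomial of degree $2\nu=m$ which is positive on $\mathbb{R}$ and has simple zeros. (Up to a constant factor this is the generalized Hermite polynomial of the partition $\lambda=(\nu,\nu)$.) For $n\ge\nu$ the corresponding exceptional Hermite polynomial of degree $m+n$ is the Wronskian $P_{m,m+n}=\mathrm{Wr}[H_\nu,H_{\nu+1},H_{n+2}]$, where $H_j$ are the classical Hermite polynomials; these are orthogonal on $\mathbb{R}$ with respect to $w(x)=e^{-x^2}/H(x)^2$, $H=d_\nu$. Known: for $n$ large $P_{m,m+n}$ has exactly $m$ non-real ("exceptional") zeros $z_k=\xi_k+i\eta_k$, $k=1,\dots,m$, and $n$ real ("regular") zeros $x_1,\dots,x_n$. $Z$ denotes the set of all these zeros.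 Let $w(z)=|e^{-z^2}|/|H(z)|^2$ on $\mathbb{C}$ and $T_w(u_1,\dots,u_{m+n})=\prod_{k}w(u_k)\prod_{k<l}|u_k-u_l|^2$. The logarithmic energy function $F=\log T_w$ is regarded as a function of $2m+n$ real variables, with $\dot z_k=\dot\xi_k+i\dot\eta_k$: $$F(\dot\xi_1,\dot\eta_1,\dots,\dot\xi_m,\dot\eta_m,\dot x_1,\dots,\dot x_n)=\sum_{k=1}^m\log w(\dot z_k)+\sum_{i=1}^n\log w(\dot x_i)+\sum_{1\le k<l\le m}\log|\dot z_k-\dot z_l|^2+\sum_{1\le i<j\le n}\log|\dot x_i-\dot x_j|^2+\sum_{k=1}^m\sum_{i=1}^n\log|\dot x_i-\dot z_k|^2 .$$ $\mathbf{H}$ is the matrix of second partial derivatives of $F$ with the variables in the order $\dot\xi_1,\dot\eta_1,\dots,\dot\xi_m,\dot\eta_m,\dot x_1,\dots,\dot x_n$; $\mathbf{H}(Z)=[h_{i,j}]$ is its value at $\dot\xi_k=\xi_k$, $\dot\eta_k=\eta_k$, $\dot x_i=x_i$. $D$ is the diagonal matrix of size $2m+n$ with $d_{kk}=1$ for $k=1,\dots,2m$ and $d_{2m+i,2m+i}=K(m)$ for $i=1,\dots,n$. A square matrix $(a_{ij})$ is diagonally dominant if $|a_{ii}|\ge\sum_{j\ne i}|a_{ij}|$ for all $i$. All first partial derivatives of $F$ vanish at $Z$; "saddle point" is to be understood in the precise sense given by the "more precisely" part of the claim. *)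

theory Defs
  imports
    "HOL-Analysis.Analysis"
    "Jordan_Normal_Form.Gauss_Jordan_Elimination"
    "Jordan_Normal_Form.Determinant"
begin

fun hermite :: "nat \<Rightarrow> real poly" where
  "hermite 0 = 1"
| "hermite (Suc 0) = [:0, 2:]"
| "hermite (Suc (Suc j)) =
     [:0, 2:] * hermite (Suc j) - Polynomial.smult (2 * real (Suc j)) (hermite j)"

(* These conditions determine the sequence h uniquely. *)
definition orthonormal_hermite :: "(nat \<Rightarrow> real poly) \<Rightarrow> bool" where
  "orthonormal_hermite h \<longleftrightarrow>
     (\<forall>j. degree (h j) = j \<and> lead_coeff (h j) > 0) \<and>
     (\<forall>i j. ((\<lambda>x. poly (h i) x * poly (h j) x * exp (- (x\<^sup>2)))
               has_integral (if i = j then 1 else 0)) UNIV)"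

definition wronskian :: "real poly list \<Rightarrow> real poly" where
  "wronskian fs = Determinant.det
     (Matrix.mat (length fs) (length fs) (\<lambda>(i, j). (pderiv ^^ i) (fs ! j)))"

definition cpoly :: "real poly \<Rightarrow> complex \<Rightarrow> complex" where
  "cpoly p z = poly (map_poly of_real p) z"

definition weight :: "real poly \<Rightarrow> complex \<Rightarrow> real" where
  "weight H z = cmod (exp (- (z\<^sup>2))) / (cmod (cpoly H z))\<^sup>2"

definition T_w :: "real poly \<Rightarrow> nat \<Rightarrow> (nat \<Rightarrow> complex) \<Rightarrow> real" where
  "T_w H N u = (\<Prod>k<N. weight H (u k)) * (\<Prod>l<N. \<Prod>k<l. (cmod (u k - u l))\<^sup>2)"

(* All indices start from 0.  The 2m+n real variables are y 0, ..., y (2m+n-1): the complex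
   points are y (2k) + i y (2k+1) for k < m, the real points are y (2m+i) for i < n. *)
definition cpoint :: "(nat \<Rightarrow> real) \<Rightarrow> nat \<Rightarrow> complex" where
  "cpoint y k = Complex (y (2 * k)) (y (2 * k + 1))"

definition rpoint :: "nat \<Rightarrow> (nat \<Rightarrow> real) \<Rightarrow> nat \<Rightarrow> real" where
  "rpoint m y i = y (2 * m + i)"

definition log_energy :: "real poly \<Rightarrow> nat \<Rightarrow> nat \<Rightarrow> (nat \<Rightarrow> real) \<Rightarrow> real" where
  "log_energy H m n y =
     (\<Sum>k<m. ln (weight H (cpoint y k)))
   + (\<Sum>i<n. ln (weight H (of_real (rpoint m y i))))
   + (\<Sum>l<m. \<Sum>k<l. ln ((cmod (cpoint y k - cpoint y l))\<^sup>2))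
   + (\<Sum>j<n. \<Sum>i<j. ln (\<bar>rpoint m y i - rpoint m y j\<bar>\<^sup>2))
   + (\<Sum>k<m. \<Sum>i<n. ln ((cmod (of_real (rpoint m y i) - cpoint y k))\<^sup>2))"

definition all_points :: "nat \<Rightarrow> (nat \<Rightarrow> real) \<Rightarrow> nat \<Rightarrow> complex" where
  "all_points m y k = (if k < m then cpoint y k else of_real (rpoint m y (k - m)))"

definition coords :: "nat \<Rightarrow> (nat \<Rightarrow> complex) \<Rightarrow> (nat \<Rightarrow> real) \<Rightarrow> nat \<Rightarrow> real" where
  "coords m z x i =
     (if i < 2 * m then (if even i then Re (z (i div 2)) else Im (z (i div 2)))
      else x (i - 2 * m))"

lemma cpoint_coords: "k < m \<Longrightarrow> cpoint (coords m z x) k = z k"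
  by (simp add: cpoint_def coords_def)

lemma rpoint_coords: "rpoint m (coords m z x) i = x i"
  by (simp add: rpoint_def coords_def)

lemma sum_split_add:
  fixes f :: "nat \<Rightarrow> 'a :: comm_monoid_add"
  shows "(\<Sum>k<m + n. f k) = (\<Sum>k<m. f k) + (\<Sum>i<n. f (m + i))"
  by (induction n) (simp_all add: add.assoc)

lemma log_energy_eq_ln_T_w:
  assumes dist: "inj_on (all_points m y) {..<m + n}"
    and nz: "\<And>k. k < m + n \<Longrightarrow> cpoly H (all_points m y k) \<noteq> 0"
  shows "log_energy H m n y = ln (T_w H (m + n) (all_points m y))"
proof -
  let ?u = "all_points m y"
  have w: "weight H (?u k) > 0" if "k < m + n" for k
    using nz[OF that] by (simp add: weight_def)
  have d: "(cmod (?u k - ?u l))\<^sup>2 > 0" if "l < m + n" "k < l" for k l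
    using inj_onD[OF dist, of k l] that by auto
  have pos: "(\<Prod>k<l. (cmod (?u k - ?u l))\<^sup>2) > 0" if "l < m + n" for l
    using d that by (intro prod_pos) auto
  have "ln (T_w H (m + n) ?u) = ln (\<Prod>k<m + n. weight H (?u k))
      + ln (\<Prod>l<m + n. \<Prod>k<l. (cmod (?u k - ?u l))\<^sup>2)"
    unfolding T_w_def using w pos d by (intro ln_mult_pos prod_pos) (simp_all only: lessThan_iff)
  also have "ln (\<Prod>k<m + n. weight H (?u k)) = (\<Sum>k<m + n. ln (weight H (?u k)))"
    by (intro ln_prod finite_lessThan) (metis lessThan_iff less_irrefl w)+
  also have "ln (\<Prod>l<m + n. \<Prod>k<l. (cmod (?u k - ?u l))\<^sup>2)
      = (\<Sum>l<m + n. ln (\<Prod>k<l. (cmod (?u k - ?u l))\<^sup>2))"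
    by (intro ln_prod finite_lessThan) (metis lessThan_iff less_irrefl pos)+
  also have "\<dots> = (\<Sum>l<m + n. \<Sum>k<l. ln ((cmod (?u k - ?u l))\<^sup>2))"
    by (intro sum.cong refl ln_prod finite_lessThan) (metis lessThan_iff less_irrefl d)+
  finally have *: "ln (T_w H (m + n) ?u) = (\<Sum>k<m + n. ln (weight H (?u k)))
      + (\<Sum>l<m + n. \<Sum>k<l. ln ((cmod (?u k - ?u l))\<^sup>2))" .
  have cross: "cmod (complex_of_real a - complex_of_real b) = \<bar>a - b\<bar>" for a b
    by (metis norm_of_real of_real_diff)
  show ?thesis
    unfolding * log_energy_def
    by (simp add: sum_split_add all_points_def sum.distrib cross norm_minus_commute
          sum.swap[of _ "{..<m}" "{..<n}"] power2_commute)
qed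

definition partial_deriv :: "nat \<Rightarrow> ((nat \<Rightarrow> real) \<Rightarrow> real) \<Rightarrow> (nat \<Rightarrow> real) \<Rightarrow> real" where
  "partial_deriv i f y = deriv (\<lambda>t. f (y(i := t))) (y i)"

definition hessian :: "nat \<Rightarrow> ((nat \<Rightarrow> real) \<Rightarrow> real) \<Rightarrow> (nat \<Rightarrow> real) \<Rightarrow> real mat" where
  "hessian N f y = Matrix.mat N N (\<lambda>(i, j). partial_deriv i (partial_deriv j f) y)"

definition scaling :: "nat \<Rightarrow> nat \<Rightarrow> real \<Rightarrow> real mat" where
  "scaling m n K = mat_diag (2 * m + n) (\<lambda>i. if i < 2 * m then 1 else K)"

definition modified_hessian :: "nat \<Rightarrow> nat \<Rightarrow> real \<Rightarrow> real mat \<Rightarrow> real mat" where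
  "modified_hessian m n K A = the (mat_inverse (scaling m n K)) * A * scaling m n K"

lemma mat_inverse_scaling:
  assumes "K \<noteq> 0"
  shows "mat_inverse (scaling m n K) = Some (scaling m n (1 / K))"
proof -
  let ?N = "2 * m + n" and ?D = "scaling m n K" and ?E = "scaling m n (1 / K)"
  have D: "?D \<in> carrier_mat ?N ?N" and E: "?E \<in> carrier_mat ?N ?N"
    by (simp_all add: scaling_def)
  have f: "(\<lambda>i. (if i < 2 * m then 1 else K) * (if i < 2 * m then 1 else 1 / K)) = (\<lambda>i. 1)"
    and g: "(\<lambda>i. (if i < 2 * m then 1 else 1 / K) * (if i < 2 * m then 1 else K)) = (\<lambda>i. 1)"
    using assms by auto
  have DE: "?D * ?E = 1\<^sub>m ?N" and ED: "?E * ?D = 1\<^sub>m ?N"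
    unfolding scaling_def mat_diag_diag f g by simp_all
  have U: "?D \<in> Units (ring_mat TYPE(real) ?N b)" for b
    unfolding Units_def ring_mat_def using D E DE ED by auto
  obtain B where B: "mat_inverse ?D = Some B"
    using mat_inverse(1)[OF D, of undefined] U[of undefined] by (cases "mat_inverse ?D") auto
  from mat_inverse(2)[OF D B] have "B * ?D = 1\<^sub>m ?N" and Bc: "B \<in> carrier_mat ?N ?N"
    by auto
  then have "B = ?E"
    using assoc_mult_mat[OF Bc D E] DE left_mult_one_mat[OF E] right_mult_one_mat[OF Bc] by simp
  with B show ?thesis by simp
qed

definition diagonally_dominant :: "real mat \<Rightarrow> bool" where
  "diagonally_dominant A \<longleftrightarrow> square_mat A \<and>
     (\<forall>i<dim_row A. \<bar>A $$ (i, i)\<bar> \<ge> (\<Sum>j\<in>{..<dim_col A} - {i}. \<bar>A $$ (i, j)\<bar>))"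

end

theory Submission
  imports
    Defs
    "HOL-Complex_Analysis.Complex_Analysis"
    "HOL-Real_Asymp.Real_Asymp"
    "Jordan_Normal_Form.Char_Poly"
begin

text \<open>
  Write \<open>f\<close>, \<open>g\<close>, \<open>y\<close> for the Hermite polynomials of degrees \<open>\<nu>\<close>, \<open>\<nu> + 1\<close> and \<open>N = n + 2\<close>, \<open>W\<close> for the
  Wronskian of \<open>f\<close> and \<open>g\<close>, and \<open>P\<close> for that of \<open>f\<close>, \<open>g\<close>, \<open>y\<close>. The orthonormal polynomials are positive
  multiples of the classical ones, so the weight involves \<open>W\<close> up to a positive constant, which no
  derivative of the energy sees.

  The energy is the real part of a multivalued holomorphic function of its points. With
  \<open>\<kappa> = 1 + (W'/W)'\<close>, the second derivative of that function with respect to a point \<open>u\<close> is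
  \<open>-2 (\<kappa>(u) + \<Sum> 1/(u - v)\<^sup>2)\<close>, summed over the other points \<open>v\<close>, and the mixed derivative with respect
  to \<open>u\<close> and \<open>v\<close> is \<open>2/(u - v)\<^sup>2\<close>. The Hessian entries are real or imaginary parts of these numbers, up
  to sign (\<open>hessian_log_energy\<close>); in particular the two diagonal entries of a complex point are opposite.

  Everything rests on the logarithmic derivative \<open>q = y'/y\<close>. Off the real axis it satisfies
  \<open>\<bar>q'\<bar> \<le> \<bar>q\<bar> / \<bar>Im z\<bar>\<close>, by an inequality that passes through the three-term recurrence, and combined
  with the Riccati equation \<open>q' = 2 z q - 2 N - q\<^sup>2\<close> this gives \<open>q\<^sup>2 = -2 N + O(\<surd>N)\<close> locally uniformly
  (\<open>hermite_logderiv_bounds\<close>). As \<open>P = 2 f g y' + (U - 2 N W) y\<close> with \<open>U\<close> independent of \<open>N\<close>, the quotient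
  \<open>P/(-2 N y)\<close> tends to \<open>W\<close> off the real axis. The zeros of \<open>W\<close> are non-real and simple and there are
  \<open>m = 2 \<nu>\<close> of them, so by Hurwitz's theorem the \<open>m\<close> non-real zeros \<open>z\<^sub>k\<close> of \<open>P\<close> converge to them, one to
  each.

  At such a zero \<open>2 N W = 2 f g q + U\<close>, so \<open>W\<close> is of size \<open>1/\<surd>N\<close> and \<open>\<kappa>(z\<^sub>k) = 2 N + o(N)\<close>
  (\<open>curv_at_exc_roots_limit\<close>). The sum of \<open>1/\<bar>z\<^sub>k - z\<^sub>l\<bar>\<^sup>2\<close> stays bounded,
  and the sum of \<open>1/\<bar>z\<^sub>k - x\<^sub>i\<bar>\<^sup>2\<close> over
  the real zeros is \<open>o(N)\<close>: replacing \<open>z\<^sub>k\<close> by a fixed point \<open>w\<close> above all zeros costs a bounded factor,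
  and the sum of \<open>1/\<bar>w - x\<^sub>i\<bar>\<^sup>2\<close> is at most \<open>\<bar>P'(w)/P(w)\<bar>\<close>. So the diagonal entries in the rows of \<open>z\<^sub>k\<close> are
  \<open>\<mp> 4 N + o(N)\<close> and all other entries of these rows, multiplied by any fixed \<open>K\<close>, add up to \<open>o(N)\<close>.

  In the row of a real zero \<open>x\<close> the terms \<open>2/(x - x\<^sub>j)\<^sup>2\<close> on and off the diagonal balance exactly, and
  what is left to dominate the columns of the complex points, scaled by \<open>1/K\<close>, is twice the real part of
  \<open>\<kappa>(x) + \<Sum> 1/(x - z\<^sub>k)\<^sup>2\<close>. Since \<open>\<kappa>(x) = 1 - \<Sum> 1/(x - \<zeta>)\<^sup>2\<close> over the zeros \<open>\<zeta>\<close> of \<open>W\<close>, the number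
  \<open>\<kappa>(x) + \<Sum> 1/(x - z\<^sub>k)\<^sup>2\<close> tends to \<open>1\<close> uniformly in \<open>x\<close>, while the competing sum is \<open>O(1/K)\<close>. A large
  \<open>K\<close>, depending only on \<open>m\<close> and on the distance of the zeros of \<open>W\<close> from the real axis, therefore
  suffices.
\<close>

section \<open>Real polynomials at complex points\<close>

lemma cpoly_0 [simp]: "cpoly 0 z = 0"
  and cpoly_1 [simp]: "cpoly 1 z = 1"
  and cpoly_pCons [simp]: "cpoly (pCons a p) z = of_real a + z * cpoly p z"
  by (simp_all add: cpoly_def Polynomial.map_poly_pCons)

lemma cpoly_add [simp]: "cpoly (p + q) z = cpoly p z + cpoly q z"
proof (induction p arbitrary: q)
  case (pCons a p)
  then show ?case by (cases q) (simp add: algebra_simps)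
qed simp

lemma cpoly_smult [simp]: "cpoly (Polynomial.smult c p) z = of_real c * cpoly p z"
  by (induction p) (simp_all add: algebra_simps)

lemma cpoly_diff [simp]: "cpoly (p - q) z = cpoly p z - cpoly q z"
  using cpoly_add[of "p - q" q z] by (simp add: algebra_simps)

lemma cpoly_mult [simp]: "cpoly (p * q) z = cpoly p z * cpoly q z"
  by (induction p) (simp_all add: algebra_simps)

lemma cpoly_of_real: "cpoly p (of_real x) = of_real (poly p x)"
  by (induction p) simp_all

lemma cpoly_deriv: "(cpoly p has_field_derivative cpoly (pderiv p) z) (at z within S)"
proof (induction p)
  case 0
  show ?case by (auto simp: cpoly_def[abs_def])
next
  case (pCons a p)
  have "((\<lambda>z. of_real a + z * cpoly p z) has_field_derivative
      (z * cpoly (pderiv p) z + cpoly p z)) (at z within S)"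
    by (auto intro!: derivative_eq_intros pCons.IH)
  then show ?case by (simp add: pderiv_pCons algebra_simps)
qed

lemma holomorphic_cpoly [holomorphic_intros]: "cpoly p holomorphic_on S"
  using cpoly_deriv holomorphic_onI field_differentiable_def by metis

lemma tendsto_cpoly [tendsto_intros]:
  "(f \<longlongrightarrow> l) F \<Longrightarrow> ((\<lambda>t. cpoly p (f t)) \<longlongrightarrow> cpoly p l) F"
  by (rule isCont_tendsto_compose[OF DERIV_isCont[OF cpoly_deriv]])

section \<open>Hermite polynomials\<close>

lemma pderiv_hermite: "pderiv (hermite j) = Polynomial.smult (2 * real j) (hermite (j - 1))"
proof (induction j rule: hermite.induct)
  case 1 show ?case by simp
next
  case 2 show ?case by (simp add: pderiv_pCons one_pCons)
next
  case (3 j)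
  show ?case
  proof (cases j)
    case 0
    then show ?thesis by (simp add: pderiv_pCons pderiv_diff pderiv_smult pderiv_mult one_pCons)
  next
    case (Suc i)
    have d: "pderiv (hermite (Suc j)) = Polynomial.smult (2 * real (Suc j)) (hermite j)"
      and d': "pderiv (hermite j) = Polynomial.smult (2 * real j) (hermite i)"
      using 3 by (simp_all add: Suc del: hermite.simps)
    have "poly (pderiv (hermite (Suc (Suc j)))) x =
      poly (Polynomial.smult (2 * real (Suc (Suc j))) (hermite (Suc j))) x" for x
    proof -
      have "poly (pderiv (hermite (Suc (Suc j)))) x =
        2 * poly (hermite (Suc j)) x + 2 * real (Suc j) *
          (2 * x * poly (hermite j) x - 2 * real j * poly (hermite i) x)"
        unfolding hermite.simps(3) pderiv_diff pderiv_smult pderiv_mult d d'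
        by (simp add: pderiv_pCons algebra_simps)
      also have "2 * x * poly (hermite j) x - 2 * real j * poly (hermite i) x = poly (hermite (Suc j)) x"
        unfolding Suc hermite.simps(3) by simp
      finally show ?thesis by (simp add: algebra_simps del: hermite.simps)
    qed
    then show ?thesis by (simp add: poly_eq_poly_eq_iff fun_eq_iff flip: poly_eq_poly_eq_iff del:
        hermite.simps)
  qed
qed

lemma hermite_Suc:
  "hermite (Suc j) = [:0, 2:] * hermite j - pderiv (hermite j)"
  by (cases j) (simp_all add: pderiv_hermite del: mult_pCons_left)

lemma hermite_ode:
  "pderiv (pderiv (hermite j)) =
     [:0, 2:] * pderiv (hermite j) - Polynomial.smult (2 * real j) (hermite j)"
proof (cases j)
  case 0 then show ?thesis by simp
next
  case (Suc i)
  have "pderiv (pderiv (hermite j)) = Polynomial.smult (2 * real j) (pderiv (hermite i))"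
    by (simp add: Suc pderiv_hermite[of "Suc i"] pderiv_smult del: hermite.simps)
  also have "pderiv (hermite i) = [:0, 2:] * hermite i - hermite j"
    by (simp add: hermite_Suc Suc)
  also have "Polynomial.smult (2 * real j) \<dots> =
     [:0, 2:] * pderiv (hermite j) - Polynomial.smult (2 * real j) (hermite j)"
    by (simp add: Suc pderiv_hermite[of "Suc i"] smult_diff_right mult_smult_right
        del: hermite.simps mult_pCons_left)
  finally show ?thesis .
qed

lemma degree_hermite_aux: "degree (hermite j) = j \<and> lead_coeff (hermite j) = 2 ^ j"
proof (induction j rule: hermite.induct)
  case (3 j)
  have nz: "hermite (Suc j) \<noteq> 0" using 3 by (metis leading_coeff_0_iff power_not_zero zero_neq_numeral)
  let ?p = "[:0, 2:] * hermite (Suc j)"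
  have d: "degree ?p = Suc (Suc j)"
    using 3 nz by (subst degree_mult_eq) auto
  have l: "degree (- Polynomial.smult (2 * real (Suc j)) (hermite j)) < degree ?p"
    unfolding d degree_minus using 3 degree_smult_le[of "2 * real (Suc j)" "hermite j"] by linarith
  have e: "hermite (Suc (Suc j)) = ?p + - Polynomial.smult (2 * real (Suc j)) (hermite j)" by simp
  have "lead_coeff (hermite (Suc (Suc j))) = lead_coeff ?p"
    unfolding e using lead_coeff_add_le[OF l] by (simp add: add.commute)
  moreover have "lead_coeff ?p = 2 * 2 ^ Suc j"
    unfolding lead_coeff_mult using 3 by (auto simp del: hermite.simps)
  moreover have "degree (hermite (Suc (Suc j))) = degree ?p"
    unfolding e using degree_add_eq_left[OF l] .
  ultimately show ?case using d by simp
qed simp_all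

lemma degree_hermite [simp]: "degree (hermite j) = j"
  and lead_coeff_hermite: "coeff (hermite j) j = 2 ^ j"
  using degree_hermite_aux[of j] by auto

lemma hermite_nonzero [simp]: "hermite j \<noteq> 0"
  using lead_coeff_hermite[of j] by force

section \<open>Quotients of Hermite polynomials off the real axis\<close>

lemma Im_minus_div: "Im (- (of_real c / r)) = c * Im r / (cmod r)\<^sup>2"
  unfolding complex_div_cnj[of _ r] by simp

text \<open>Off the real axis the quotient \<open>r = h\<^sub>j\<^sub>+\<^sub>1/h\<^sub>j\<close> of consecutive Hermite polynomials has imaginary part
  of the sign of \<open>Im z\<close>, and its derivative is bounded by \<open>Im r / Im z\<close>. Both properties are preserved
  by the recurrence \<open>r \<mapsto> 2 z - c/r\<close> with \<open>c > 0\<close>; in particular no Hermite polynomial vanishes there.\<close>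
lemma hermite_quotient:
  assumes z: "Im z \<noteq> 0"
  defines "h \<equiv> \<lambda>j. cpoly (hermite j) z"
    and "h' \<equiv> \<lambda>j. cpoly (pderiv (hermite j)) z"
  shows "h j \<noteq> 0 \<and> 0 < Im (h (Suc j) / h j) / Im z \<and>
     cmod ((h' (Suc j) * h j - h (Suc j) * h' j) / (h j)\<^sup>2) \<le> Im (h (Suc j) / h j) / Im z"
proof (induction j)
  case 0
  show ?case using z by (simp add: h_def h'_def pderiv_pCons)
next
  case (Suc j)
  define r where "r = h (Suc j) / h j"
  define d where "d = (h' (Suc j) * h j - h (Suc j) * h' j) / (h j)\<^sup>2"
  define c where "c = 2 * real (Suc j)"
  have hj: "h j \<noteq> 0" and r: "0 < Im r / Im z" and d: "cmod d \<le> Im r / Im z"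
    using Suc by (simp_all add: r_def d_def)
  have r0: "r \<noteq> 0" using r by auto
  have hS: "h (Suc j) \<noteq> 0" using r0 by (auto simp: r_def)
  \<comment> \<open>the recurrence and its derivative turn the quotient \<open>r\<close> into \<open>2 z - c/r\<close>\<close>
  have rec: "h (Suc (Suc j)) = 2 * z * h (Suc j) - of_real c * h j"
    by (simp add: h_def c_def algebra_simps)
  have rec': "h' (Suc (Suc j)) = 2 * h (Suc j) + 2 * z * h' (Suc j) - of_real c * h' j"
    unfolding h_def h'_def hermite.simps(3)
    by (simp add: c_def pderiv_diff pderiv_smult pderiv_mult pderiv_pCons algebra_simps del: hermite.simps)
  have e1: "h (Suc (Suc j)) / h (Suc j) = 2 * z + - (of_real c / r)"
    using hS hj unfolding rec r_def by (simp add: field_simps)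
  have e2: "(h' (Suc (Suc j)) * h (Suc j) - h (Suc (Suc j)) * h' (Suc j)) / (h (Suc j))\<^sup>2
      = 2 + of_real c * d / r\<^sup>2"
    using hS hj unfolding rec rec' r_def d_def by (simp add: field_simps power2_eq_square)
  have im: "Im (h (Suc (Suc j)) / h (Suc j)) / Im z = 2 + c * (Im r / Im z) / (cmod r)\<^sup>2"
    unfolding e1 plus_complex.sel Im_minus_div using z by (simp add: field_simps)
  have c: "c > 0" by (simp add: c_def)
  have pos: "c * (Im r / Im z) / (cmod r)\<^sup>2 > 0"
    using mult_pos_pos[OF c r] r0 by (intro divide_pos_pos) auto
  have "cmod (2 + of_real c * d / r\<^sup>2) \<le> 2 + c * cmod d / (cmod r)\<^sup>2"
    using norm_triangle_ineq[of 2 "of_real c * d / r\<^sup>2"] c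
    by (simp add: norm_mult norm_divide norm_power)
  also have "\<dots> \<le> 2 + c * (Im r / Im z) / (cmod r)\<^sup>2"
    using d c by (intro add_left_mono divide_right_mono mult_left_mono) auto
  finally show ?case
    unfolding im e2 using hS pos by simp
qed

lemma cpoly_hermite_nonzero: "Im z \<noteq> 0 \<Longrightarrow> cpoly (hermite j) z \<noteq> 0"
  using hermite_quotient[of z j] by blast

text \<open>The logarithmic derivative of the \<open>N\<close>-th Hermite polynomial.\<close>
definition hermite_logderiv :: "nat \<Rightarrow> complex \<Rightarrow> complex" where
  "hermite_logderiv N z = cpoly (pderiv (hermite N)) z / cpoly (hermite N) z"

lemma cpoly_hermite_ode:
  "cpoly (pderiv (pderiv (hermite j))) z =
     2 * z * cpoly (pderiv (hermite j)) z - 2 * of_nat j * cpoly (hermite j) z"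
  by (simp add: hermite_ode algebra_simps)

text \<open>By the Hermite equation the number inside the norm is minus the derivative of the logarithmic
  derivative.\<close>
lemma hermite_logderiv_riccati:
  assumes z: "Im z \<noteq> 0"
  shows "cmod ((hermite_logderiv N z)\<^sup>2 + 2 * of_nat N - 2 * z * hermite_logderiv N z) \<le> cmod
      (hermite_logderiv N z) / \<bar>Im z\<bar>"
proof (cases N)
  case 0
  then show ?thesis by (simp add: hermite_logderiv_def)
next
  case (Suc j)
  define a b a' b' where "a = cpoly (hermite N) z" and "b = cpoly (hermite j) z"
    and "a' = cpoly (pderiv (hermite N)) z" and "b' = cpoly (pderiv (hermite j)) z"
  define r where "r = a / b"
  define d where "d = (a' * b - a * b') / b\<^sup>2"
  have a: "a \<noteq> 0" and b: "b \<noteq> 0" using cpoly_hermite_nonzero[OF z] by (auto simp: a_def b_def)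
  have d: "cmod d \<le> Im r / Im z"
    using hermite_quotient[OF z, of j] by (simp add: d_def r_def a_def b_def a'_def b'_def Suc)
  have p: "pderiv (hermite N) = Polynomial.smult (2 * real N) (hermite j)"
    by (simp add: pderiv_hermite Suc del: hermite.simps)
  have a'b: "a' = 2 * of_nat N * b" unfolding a'_def b_def p by simp
  have ode: "2 * of_nat N * b' = 2 * z * a' - 2 * of_nat N * a"
    using cpoly_hermite_ode[of N z] unfolding p pderiv_smult a'_def a_def b'_def b_def by simp
  have q: "hermite_logderiv N z = a' / a" by (simp add: hermite_logderiv_def a'_def a_def)
  have "(hermite_logderiv N z)\<^sup>2 + 2 * of_nat N - 2 * z * hermite_logderiv N z = (a' * a' - (2 * z *
      a' - 2 * of_nat N * a) * a) / a\<^sup>2"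
    unfolding q using a by (simp add: field_simps power2_eq_square)
  also have "\<dots> = 2 * of_nat N * (a' * b - a * b') / a\<^sup>2"
    unfolding ode[symmetric] by (subst (1) a'b) (simp add: algebra_simps)
  also have "\<dots> = 2 * of_nat N * d / r\<^sup>2"
    using a b by (simp add: d_def r_def field_simps)
  also have "cmod \<dots> = 2 * real N * cmod d / (cmod r)\<^sup>2"
    by (simp add: norm_mult norm_divide norm_power)
  also have "\<dots> \<le> 2 * real N * (cmod r / \<bar>Im z\<bar>) / (cmod r)\<^sup>2"
  proof -
    have "Im r / Im z \<le> \<bar>Im r / Im z\<bar>" by (rule abs_ge_self)
    also have "\<dots> \<le> cmod r / \<bar>Im z\<bar>"
      by (simp add: abs_divide divide_right_mono abs_Im_le_cmod)
    finally have "cmod d \<le> cmod r / \<bar>Im z\<bar>" using d by linarith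
    then show ?thesis by (intro divide_right_mono mult_left_mono) auto
  qed
  also have "\<dots> = cmod (hermite_logderiv N z) / \<bar>Im z\<bar>"
    using a b unfolding q r_def a'b by (simp add: norm_mult norm_divide field_simps power2_eq_square)
  finally show ?thesis .
qed

lemma hermite_logderiv_bounds:
  assumes z: "Im z \<noteq> 0" and M: "2 * cmod z + 1 / \<bar>Im z\<bar> \<le> M"
  shows "cmod (hermite_logderiv N z) \<le> M + sqrt (2 * real N)"
    and "cmod ((hermite_logderiv N z)\<^sup>2 + 2 * of_nat N) \<le> M * (M + sqrt (2 * real N))"
proof -
  let ?q = "hermite_logderiv N z"
  have "cmod (?q\<^sup>2 + 2 * of_nat N) \<le> cmod (?q\<^sup>2 + 2 * of_nat N - 2 * z * ?q) + cmod (2 * z * ?q)"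
    using norm_triangle_ineq[of "?q\<^sup>2 + 2 * of_nat N - 2 * z * ?q" "2 * z * ?q"] by simp
  also have "\<dots> \<le> (2 * cmod z + 1 / \<bar>Im z\<bar>) * cmod ?q"
    using hermite_logderiv_riccati[OF z, of N] by (simp add: norm_mult algebra_simps)
  also have "\<dots> \<le> M * cmod ?q" using M by (rule mult_right_mono) simp
  finally have 1: "cmod (?q\<^sup>2 + 2 * of_nat N) \<le> M * cmod ?q" .
  have M0: "M \<ge> 0" using M z by (smt (verit) divide_nonneg_nonneg norm_ge_zero abs_ge_zero)
  have "(cmod ?q)\<^sup>2 \<le> cmod (?q\<^sup>2 + 2 * of_nat N) + cmod (2 * of_nat N :: complex)"
    using norm_triangle_ineq4[of "?q\<^sup>2 + 2 * of_nat N" "2 * of_nat N"] by (simp add: norm_power)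
  then have 2: "(cmod ?q)\<^sup>2 \<le> M * cmod ?q + 2 * real N"
    using 1 by (simp add: norm_mult)
  show 3: "cmod ?q \<le> M + sqrt (2 * real N)"
  proof (rule ccontr)
    assume "\<not> ?thesis"
    then have a: "cmod ?q > M + sqrt (2 * real N)" by simp
    then have "cmod ?q * cmod ?q \<ge> (M + sqrt (2 * real N)) * cmod ?q" by (intro mult_right_mono) auto
    moreover have "sqrt (2 * real N) * cmod ?q \<ge> sqrt (2 * real N) * sqrt (2 * real N)"
      using a M0 by (intro mult_left_mono) auto
    ultimately have e: "2 * real N = sqrt (2 * real N) * cmod ?q" using 2 by (simp add:
        power2_eq_square algebra_simps)
    show False
    proof (cases "N = 0")
      case True then show False using a M0 by (simp add: hermite_logderiv_def)
    next
      case False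
      have "sqrt (2 * real N) * sqrt (2 * real N) < sqrt (2 * real N) * cmod ?q"
        using a M0 False by (intro mult_strict_left_mono) auto
      then show False using e by simp
    qed
  qed
  show "cmod (?q\<^sup>2 + 2 * of_nat N) \<le> M * (M + sqrt (2 * real N))"
    using 1 mult_left_mono[OF 3 M0] by linarith
qed

section \<open>Wronskians of Hermite polynomials\<close>

lemma wronskian_2: "wronskian [f, g] = f * pderiv g - g * pderiv f"
proof -
  define A where "A = Matrix.mat 2 2 (\<lambda>(i, j). (pderiv ^^ i) ([f, g] ! j))"
  have "Determinant.det A = f * pderiv g - g * pderiv f"
    by (subst laplace_expansion_row[of A 2 0])
      (auto simp: A_def cofactor_def mat_delete_def det_single numeral_2_eq_2 lessThan_Suc)
  then show ?thesis by (simp add: wronskian_def A_def numeral_2_eq_2)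
qed

lemma wronskian_3:
  "wronskian [f, g, y] = f * (pderiv g * pderiv (pderiv y) - pderiv y * pderiv (pderiv g))
     - g * (pderiv f * pderiv (pderiv y) - pderiv y * pderiv (pderiv f))
     + y * (pderiv f * pderiv (pderiv g) - pderiv g * pderiv (pderiv f))"
proof -
  have det2: "Determinant.det B = B $$ (0,0) * B $$ (1,1) - B $$ (0,1) * B $$ (1,0)"
    if "B \<in> carrier_mat 2 2" for B :: "real poly mat"
    using that by (subst laplace_expansion_row[of B 2 0])
      (auto simp: cofactor_def mat_delete_def det_single numeral_2_eq_2 lessThan_Suc)
  define A where "A = Matrix.mat 3 3 (\<lambda>(i, j). (pderiv ^^ i) ([f, g, y] ! j))"
  have "Determinant.det A = f * (pderiv g * pderiv (pderiv y) - pderiv y * pderiv (pderiv g))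
     - g * (pderiv f * pderiv (pderiv y) - pderiv y * pderiv (pderiv f))
     + y * (pderiv f * pderiv (pderiv g) - pderiv g * pderiv (pderiv f))"
    by (subst laplace_expansion_row[of A 3 0])
      (auto simp: A_def cofactor_def mat_delete_def det2 numeral_3_eq_3 numeral_2_eq_2 lessThan_Suc,
        simp add: algebra_simps)
  then show ?thesis by (simp add: wronskian_def A_def numeral_3_eq_3)
qed

text \<open>The Wronskian of two consecutive classical Hermite polynomials, a positive multiple of \<open>d\<^sub>\<nu>\<close>.\<close>
definition hermite_wr :: "nat \<Rightarrow> real poly" where
  "hermite_wr \<nu> = wronskian [hermite \<nu>, hermite (Suc \<nu>)]"

text \<open>This recurrence yields positivity on the real line and the degree.\<close>
lemma hermite_wr_Suc:
  "hermite_wr (Suc k) = Polynomial.smult 2 (hermite (Suc k) * hermite (Suc k)) + Polynomial.smult (2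
      * real (Suc k)) (hermite_wr k)"
proof -
  have "poly (hermite_wr (Suc k)) x = poly (Polynomial.smult 2 (hermite (Suc k) * hermite (Suc k)) +
      Polynomial.smult (2 * real (Suc k)) (hermite_wr k)) x" for x
    unfolding hermite_wr_def wronskian_2 hermite.simps(3)
    by (simp add: pderiv_diff pderiv_smult pderiv_mult pderiv_pCons algebra_simps del: hermite.simps)
  then show ?thesis by (simp add: fun_eq_iff flip: poly_eq_poly_eq_iff del: hermite.simps)
qed

lemma hermite_wr_pos: "poly (hermite_wr k) x > 0"
proof (induction k)
  case 0 then show ?case by (simp add: hermite_wr_def wronskian_2 pderiv_pCons)
next
  case (Suc k)
  then show ?case unfolding hermite_wr_Suc
    by (simp add: add_nonneg_pos del: hermite.simps)
qed

lemma degree_hermite_wr: "degree (hermite_wr k) = 2 * k"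
proof -
  have "degree (hermite_wr k) \<le> 2 * k \<and> coeff (hermite_wr k) (2 * k) \<noteq> 0"
  proof (cases k)
    case 0 then show ?thesis by (simp add: hermite_wr_def wronskian_2 pderiv_pCons)
  next
    case (Suc j)
    have *: "degree (hermite_wr j) \<le> 2 * j" for j
    proof (induction j)
      case (Suc j)
      then show ?case unfolding hermite_wr_Suc
        by (intro degree_add_le order.trans[OF degree_smult_le] order.trans[OF degree_mult_le])
          (auto simp del: hermite.simps)
    qed (simp add: hermite_wr_def wronskian_2 pderiv_pCons)
    have "coeff (hermite_wr k) (2 * k) = 2 * coeff (hermite k * hermite k) (k + k) + 2 * real k *
        coeff (hermite_wr j) (2 * k)"
      unfolding mult_2[of k] unfolding Suc hermite_wr_Suc by (simp del: hermite.simps)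
    also have "coeff (hermite_wr j) (2 * k) = 0"
      using *[of j] Suc by (intro coeff_eq_0) auto
    also have "coeff (hermite k * hermite k) (k + k) = 2 ^ k * 2 ^ k"
      using coeff_mult_degree_sum[of "hermite k" "hermite k"] by (simp add: lead_coeff_hermite)
    finally show ?thesis using *[of k] by simp
  qed
  then show ?thesis using le_degree[of "hermite_wr k" "2 * k"] by auto
qed

lemma pderiv_hermite_wr:
  "pderiv (hermite_wr \<nu>) = [:0, 2:] * hermite_wr \<nu> - Polynomial.smult 2 (hermite \<nu> * hermite (Suc \<nu>))"
proof -
  have "poly (pderiv (hermite_wr \<nu>)) x =
      poly ([:0, 2:] * hermite_wr \<nu> - Polynomial.smult 2 (hermite \<nu> * hermite (Suc \<nu>))) x" for x
    unfolding hermite_wr_def wronskian_2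
    by (simp add: pderiv_diff pderiv_mult hermite_ode algebra_simps del: hermite.simps)
  then show ?thesis by (simp add: fun_eq_iff flip: poly_eq_poly_eq_iff del: hermite.simps)
qed

lemma cpoly_pderiv_hermite_wr:
  "cpoly (pderiv (hermite_wr k)) z =
     2 * z * cpoly (hermite_wr k) z - 2 * (cpoly (hermite k) z * cpoly (hermite (Suc k)) z)"
  by (simp add: pderiv_hermite_wr del: hermite.simps)

text \<open>The polynomial \<open>U\<close>: the Wronskian defined next is \<open>2 f g y' + (U - 2 N W) y\<close>, where \<open>f\<close>, \<open>g\<close>, \<open>y\<close> are
  its entries.\<close>
definition exc_rest :: "nat \<Rightarrow> real poly" where
  "exc_rest \<nu> = Polynomial.smult (2 * real \<nu>) (hermite \<nu> * pderiv (hermite (Suc \<nu>)))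
     - Polynomial.smult (2 * real (Suc \<nu>)) (pderiv (hermite \<nu>) * hermite (Suc \<nu>))"

text \<open>The Wronskian whose zeros form the configuration of the theorem, indexed by the degree \<open>N\<close> of the
  last Hermite polynomial (so \<open>N = n + 2\<close> for the exceptional polynomial with \<open>n\<close> real zeros).\<close>
definition exc :: "nat \<Rightarrow> nat \<Rightarrow> real poly" where
  "exc \<nu> N = wronskian [hermite \<nu>, hermite (Suc \<nu>), hermite N]"

lemma exc_eq:
  "exc \<nu> N = Polynomial.smult 2 (hermite \<nu> * hermite (Suc \<nu>)) * pderiv (hermite N)
     + (exc_rest \<nu> - Polynomial.smult (2 * real N) (hermite_wr \<nu>)) * hermite N"
proof -
  have "poly (exc \<nu> N) x = poly (Polynomial.smult 2 (hermite \<nu> * hermite (Suc \<nu>)) * pderiv (hermite N)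
     + (exc_rest \<nu> - Polynomial.smult (2 * real N) (hermite_wr \<nu>)) * hermite N) x" for x
    unfolding exc_def wronskian_3 hermite_wr_def wronskian_2 exc_rest_def hermite_ode
    by (simp add: algebra_simps of_nat_Suc del: hermite.simps)
  then show ?thesis by (simp add: fun_eq_iff flip: poly_eq_poly_eq_iff del: hermite.simps)
qed

text \<open>The form as a determinant shows this bound; in the shorter form above two degrees cancel.\<close>
lemma degree_exc_le:
  assumes "\<nu> \<ge> 1" shows "degree (exc \<nu> (n + 2)) \<le> 2 * \<nu> + n"
proof -
  have d: "degree (p * (q * r)) \<le> 2 * \<nu> + n"
    if "degree p + (degree q + degree r) \<le> 2 * \<nu> + n" for p q r :: "real poly"
    using that degree_mult_le[of p "q * r"] degree_mult_le[of q r] by linarith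
  \<comment> \<open>for \<open>\<nu> = 1\<close> the second derivative vanishes and its degree 0 is not \<open>\<nu> - 2\<close>\<close>
  have d': "degree (p * (q * pderiv (pderiv (hermite \<nu>)))) \<le> 2 * \<nu> + n"
    if "degree p + degree q \<le> \<nu> + n + 2" for p q :: "real poly"
  proof (cases "\<nu> = 1")
    case True
    then show ?thesis by (simp add: pderiv_pCons)
  next
    case False
    then show ?thesis
      by (intro d) (use assms that in \<open>auto simp: degree_pderiv simp del: hermite.simps\<close>)
  qed
  show ?thesis
    unfolding exc_def wronskian_3 right_diff_distrib
    by (intro degree_add_le degree_diff_le d' d)
      (use assms in \<open>auto simp: degree_pderiv simp del: hermite.simps\<close>)
qed

section \<open>Orthonormal Hermite polynomials\<close>

lemma poly_graded_expansion:
  fixes h :: "nat \<Rightarrow> 'a :: field poly"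
  assumes h: "\<And>j. degree (h j) = j" "\<And>j. h j \<noteq> 0"
  shows "degree p < n \<or> p = 0 \<Longrightarrow> \<exists>c. p = (\<Sum>i<n. Polynomial.smult (c i) (h i))"
proof (induction n arbitrary: p)
  case (Suc n)
  define d where "d = coeff p n / coeff (h n) n"
  define q where "q = p - Polynomial.smult d (h n)"
  have l: "coeff (h n) n \<noteq> 0" using h[of n] by (metis leading_coeff_0_iff)
  have "degree q \<le> n"
    unfolding q_def using Suc.prems h(1)[of n] degree_smult_le[of d "h n"]
    by (intro degree_diff_le) auto
  moreover have "coeff q n = 0" using l by (simp add: q_def d_def)
  ultimately have "degree q < n \<or> q = 0"
    using leading_coeff_0_iff[of q] by (cases "degree q = n") auto
  from Suc.IH[OF this] obtain c where c: "q = (\<Sum>i<n. Polynomial.smult (c i) (h i))" ..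
  have "p = (\<Sum>i<n. Polynomial.smult (c i) (h i)) + Polynomial.smult d (h n)"
    using c by (simp add: q_def algebra_simps)
  also have "\<dots> = (\<Sum>i<Suc n. Polynomial.smult ((c(n := d)) i) (h i))" by simp
  finally show ?case by blast
qed simp

text \<open>Integration of a polynomial against \<open>exp (-x\<^sup>2)\<close>. Given an orthonormal system, every polynomial is
  integrable, because the system spans all polynomials and its first member is a nonzero constant.\<close>
definition gauss_int :: "real poly \<Rightarrow> real" where
  "gauss_int p = integral UNIV (\<lambda>x. poly p x * exp (- (x\<^sup>2)))"

context
  fixes h :: "nat \<Rightarrow> real poly"
  assumes h: "orthonormal_hermite h"
begin

lemma h_degree: "degree (h j) = j" and h_nonzero: "h j \<noteq> 0"
  and h_lead: "coeff (h j) j > 0"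
proof -
  have "degree (h j) = j \<and> lead_coeff (h j) > 0" using h unfolding orthonormal_hermite_def by blast
  then show "degree (h j) = j" "h j \<noteq> 0" "coeff (h j) j > 0" by auto
qed

lemma gauss_integrable:
  fixes p :: "real poly"
  shows "(\<lambda>x. poly p x * exp (- (x\<^sup>2))) integrable_on UNIV"
proof -
  define n where "n = Suc (degree p)"
  obtain c where c: "p = (\<Sum>i<n. Polynomial.smult (c i) (h i))"
    using poly_graded_expansion[of h p n] h_degree h_nonzero by (auto simp: n_def)
  obtain c0 where c0: "h 0 = [:c0:]" using h_degree[of 0] by (rule degree_eq_zeroE)
  have "c0 > 0" using h_lead[of 0] c0 by simp
  have "(\<lambda>x. poly (h i) x * poly (h 0) x * exp (- (x\<^sup>2))) integrable_on UNIV" for i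
    using h unfolding orthonormal_hermite_def by blast
  then have "(\<lambda>x. \<Sum>i<n. (c i / c0) * (poly (h i) x * poly (h 0) x * exp (- (x\<^sup>2)))) integrable_on UNIV"
    by (intro integrable_sum integrable_on_mult_right) auto
  also have "(\<lambda>x. \<Sum>i<n. (c i / c0) * (poly (h i) x * poly (h 0) x * exp (- (x\<^sup>2))))
     = (\<lambda>x. poly p x * exp (- (x\<^sup>2)))"
    unfolding c using \<open>c0 > 0\<close> by (auto simp: c0 poly_sum sum_distrib_right intro!: sum.cong ext)
  finally show ?thesis .
qed

lemma gauss_int_add: "gauss_int (p + q) = gauss_int p + gauss_int q"
  unfolding gauss_int_def
  by (subst integral_add[symmetric]) (auto intro!: gauss_integrable simp: algebra_simps)

lemma gauss_int_smult: "gauss_int (Polynomial.smult c p) = c * gauss_int p"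
  unfolding gauss_int_def by (simp add: mult.assoc)

lemma gauss_int_0: "gauss_int 0 = 0"
  by (simp add: gauss_int_def)

lemma gauss_int_diff: "gauss_int (p - q) = gauss_int p - gauss_int q"
  using gauss_int_add[of p "- q"] gauss_int_smult[of "-1" q] by simp

lemma gauss_int_h: "gauss_int (h i * h j) = (if i = j then 1 else 0)"
proof -
  have "((\<lambda>x. poly (h i) x * poly (h j) x * exp (- (x\<^sup>2))) has_integral (if i = j then 1 else 0)) UNIV"
    using h unfolding orthonormal_hermite_def by blast
  then show ?thesis unfolding gauss_int_def poly_mult by (rule integral_unique)
qed

lemma gauss_tendsto_at_top:
  fixes p :: "real poly"
  shows "((\<lambda>x. poly p x * exp (- (x\<^sup>2))) \<longlongrightarrow> 0) at_top"
proof -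
  have m: "((\<lambda>x :: real. x ^ k * exp (- (x\<^sup>2))) \<longlongrightarrow> 0) at_top" for k :: nat
    by real_asymp
  have "((\<lambda>x. \<Sum>i\<le>degree p. coeff p i * (x ^ i * exp (- (x\<^sup>2)))) \<longlongrightarrow> 0) at_top"
    by (intro tendsto_null_sum tendsto_mult_right_zero m)
  then show ?thesis by (simp add: poly_altdef sum_distrib_right mult.assoc)
qed

lemma gauss_int_by_parts: "gauss_int (pderiv p - [:0, 2:] * p) = 0"
proof -
  define F where "F x = poly p x * exp (- (x\<^sup>2))" for x
  define r where "r = pderiv p - [:0, 2:] * p"
  define I where "I = gauss_int r"
  have I: "((\<lambda>x. poly r x * exp (- (x\<^sup>2))) has_integral I) UNIV"
    using gauss_integrable unfolding I_def gauss_int_def by (rule integrable_integral)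
  have FTC: "((\<lambda>x. poly r x * exp (- (x\<^sup>2))) has_integral (F b - F a)) {a..b}" if "a \<le> b" for a b
  proof (rule fundamental_theorem_of_calculus[OF that])
    fix x assume "x \<in> {a..b}"
    have "((\<lambda>x. exp (- (x\<^sup>2))) has_real_derivative exp (- (x\<^sup>2)) * (- (2 * x))) (at x within {a..b})"
      by (auto intro!: derivative_eq_intros)
    from DERIV_mult[OF has_field_derivative_at_within[OF poly_DERIV[of p x]] this]
    have "(F has_real_derivative poly r x * exp (- (x\<^sup>2))) (at x within {a..b})"
      unfolding F_def r_def by (rule DERIV_cong) (simp add: algebra_simps)
    then show "(F has_vector_derivative poly r x * exp (- (x\<^sup>2))) (at x within {a..b})"
      by (simp add: has_real_derivative_iff_has_vector_derivative)
  qed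
  have lim1: "(F \<longlongrightarrow> 0) at_top" unfolding F_def by (rule gauss_tendsto_at_top)
  have lim2: "((\<lambda>x. F (- x)) \<longlongrightarrow> 0) at_top"
    using gauss_tendsto_at_top[of "pcompose p [:0, -1:]"] by (simp add: F_def poly_pcompose)
  have no_cbox: "\<nexists>a b. (UNIV :: real set) = cbox a b"
    by (metis not_bounded_UNIV bounded_cbox)
  have "\<bar>I\<bar> \<le> e" if "e > 0" for e
  proof -
    have "e / 3 > 0" using that by simp
    from has_integral_altD[OF I no_cbox this] obtain B where B: "B > 0"
      and Bi: "\<And>a b. ball 0 B \<subseteq> cbox a b \<Longrightarrow>
        \<exists>z. ((\<lambda>x. if x \<in> UNIV then poly r x * exp (- (x\<^sup>2)) else 0) has_integral z) (cbox a b) \<and>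
            norm (z - I) < e / 3"
      by blast
    have "\<forall>\<^sub>F b in at_top. \<bar>F b\<bar> < e / 3 \<and> \<bar>F (- b)\<bar> < e / 3 \<and> b \<ge> B"
      using tendstoD[OF lim1 \<open>e / 3 > 0\<close>] tendstoD[OF lim2 \<open>e / 3 > 0\<close>] eventually_ge_at_top[of B]
      by eventually_elim simp
    then obtain b where b: "\<bar>F b\<bar> < e / 3" "\<bar>F (- b)\<bar> < e / 3" "b \<ge> B"
      by (auto simp: eventually_at_top_linorder)
    have "ball 0 B \<subseteq> cbox (- b) b" using b(3) by (auto simp: dist_norm)
    from Bi[OF this] obtain z where z: "((\<lambda>x. poly r x * exp (- (x\<^sup>2))) has_integral z) {- b..b}"
      "\<bar>z - I\<bar> < e / 3" by auto
    have "z = F b - F (- b)"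
      using has_integral_unique[OF z(1) FTC[of "- b" b]] b(3) B by simp
    then show ?thesis using b z(2) by linarith
  qed
  then have "\<bar>I\<bar> \<le> 0" by (rule field_le_epsilon) simp
  then have "I = 0" by simp
  then show ?thesis by (simp add: I_def r_def)
qed

lemma gauss_int_hermite: "degree q < j \<or> q = 0 \<Longrightarrow> gauss_int (hermite j * q) = 0"
proof (induction j arbitrary: q)
  case 0
  then show ?case by (simp add: gauss_int_def)
next
  case (Suc j)
  have "hermite (Suc j) * q = hermite j * pderiv q - (pderiv (hermite j * q) - [:0, 2:] * (hermite j * q))"
    unfolding hermite_Suc by (simp add: pderiv_mult algebra_simps del: mult_pCons_left mult_pCons_right)
  then have "gauss_int (hermite (Suc j) * q) = gauss_int (hermite j * pderiv q)"
    using gauss_int_by_parts[of "hermite j * q"]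
      gauss_int_diff[of "hermite j * pderiv q" "pderiv (hermite j * q) - [:0, 2:] * (hermite j * q)"]
    by (simp only: diff_zero)
  moreover have "degree (pderiv q) < j \<or> pderiv q = 0"
    using Suc.prems by (auto simp: degree_pderiv pderiv_eq_0_iff)
  ultimately show ?case using Suc.IH by simp
qed

text \<open>The difference of the two sides is a combination of the earlier members of the orthonormal
  system and is orthogonal to all of them.\<close>
lemma orthonormal_hermite_eq:
  "h j = Polynomial.smult (coeff (h j) j / 2 ^ j) (hermite j)"
proof -
  define c where "c = coeff (h j) j / 2 ^ j"
  define r where "r = h j - Polynomial.smult c (hermite j)"
  have "degree r \<le> j"
    unfolding r_def using h_degree[of j] degree_smult_le[of c "hermite j"] by (intro degree_diff_le) auto
  moreover have "coeff r j = 0" by (simp add: r_def c_def lead_coeff_hermite)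
  ultimately have "degree r < j \<or> r = 0"
    using leading_coeff_0_iff[of r] by (cases "degree r = j") auto
  then obtain b where b: "r = (\<Sum>i<j. Polynomial.smult (b i) (h i))"
    using poly_graded_expansion[of h r j] h_degree h_nonzero by auto
  have sum: "gauss_int (\<Sum>i\<in>A. f i) = (\<Sum>i\<in>A. gauss_int (f i))" for A :: "nat set" and f
    by (induction A rule: infinite_finite_induct) (simp_all add: gauss_int_add gauss_int_0)
  have "b k = 0" if k: "k < j" for k
  proof -
    have "gauss_int (r * h k) = gauss_int (h j * h k) - c * gauss_int (hermite j * h k)"
      unfolding r_def by (simp add: left_diff_distrib gauss_int_diff gauss_int_smult)
    also have "\<dots> = 0" using k h_degree[of k] by (simp add: gauss_int_h gauss_int_hermite)
    finally have "0 = gauss_int (\<Sum>i<j. Polynomial.smult (b i) (h i * h k))"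
      by (simp add: b sum_distrib_right)
    also have "\<dots> = (\<Sum>i<j. if i = k then b k else 0)"
      unfolding sum by (intro sum.cong) (auto simp: gauss_int_smult gauss_int_h)
    also have "\<dots> = b k" using k by simp
    finally show ?thesis by simp
  qed
  then have "r = 0" by (simp add: b)
  then show ?thesis by (simp add: r_def c_def)
qed

lemma wronskian_orthonormal_hermite:
  "\<exists>c>0. wronskian [h \<nu>, h (Suc \<nu>)] = Polynomial.smult c (hermite_wr \<nu>)"
proof -
  let ?c = "\<lambda>j. coeff (h j) j / 2 ^ j"
  have "wronskian [h \<nu>, h (Suc \<nu>)] = Polynomial.smult (?c \<nu> * ?c (Suc \<nu>)) (hermite_wr \<nu>)"
  proof -
    have "wronskian [Polynomial.smult a p, Polynomial.smult b q] =
        Polynomial.smult (a * b) (wronskian [p, q])" for a b and p q :: "real poly"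
      by (simp add: wronskian_2 pderiv_smult smult_diff_right mult.commute)
    then show ?thesis
      unfolding hermite_wr_def using orthonormal_hermite_eq by metis
  qed
  then show ?thesis using h_lead[of \<nu>] h_lead[of "Suc \<nu>"] by (intro exI[of _ "?c \<nu> * ?c (Suc \<nu>)"]) auto
qed

end

section \<open>Simple zeros and logarithmic derivatives\<close>

lemma degree_cpoly: "degree (map_poly complex_of_real p) = degree p"
  by (rule degree_map_poly) simp

lemma cpoly_linear_factors:
  assumes p: "p \<noteq> 0" and deg: "degree p \<le> card {z. cpoly p z = 0}"
  obtains c where "c \<noteq> 0" "\<And>z. cpoly p z = c * (\<Prod>r | cpoly p r = 0. z - r)"
proof -
  let ?P = "map_poly complex_of_real p"
  have P: "?P \<noteq> 0" using p by (simp add: map_poly_eq_0_iff)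
  have c: "cpoly p z = poly ?P z" for z by (simp add: cpoly_def)
  have "card {z. poly ?P z = 0} = degree ?P"
    using deg card_poly_roots_bound[OF P] unfolding c degree_cpoly by simp
  then have "rsquarefree ?P" using rsquarefree_card_degree[OF P] by simp
  then have *: "?P = Polynomial.smult (lead_coeff ?P) (\<Prod>z | poly ?P z = 0. [:- z, 1:])"
    by (rule complex_poly_decompose_rsquarefree[symmetric])
  have "cpoly p z = lead_coeff ?P * (\<Prod>r | cpoly p r = 0. z - r)" for z
    unfolding c by (subst *) (simp add: poly_prod)
  moreover have "lead_coeff ?P \<noteq> 0" using P by simp
  ultimately show ?thesis using that by blast
qed

lemma finite_cpoly_roots: "p \<noteq> 0 \<Longrightarrow> finite {z. cpoly p z = 0}"
  unfolding cpoly_def by (rule poly_roots_finite) (simp add: map_poly_eq_0_iff)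

text \<open>The hypothesis on the number of zeros says that all zeros are simple.\<close>
lemma cpoly_log_deriv:
  assumes p: "p \<noteq> 0" and deg: "degree p \<le> card {z. cpoly p z = 0}" and z: "cpoly p z \<noteq> 0"
  shows "cpoly (pderiv p) z / cpoly p z = (\<Sum>r | cpoly p r = 0. 1 / (z - r))"
proof -
  obtain c where c: "c \<noteq> 0" "\<And>z. cpoly p z = c * (\<Prod>r | cpoly p r = 0. z - r)"
    using cpoly_linear_factors[OF p deg] by blast
  have D: "((\<lambda>z. \<Prod>r\<in>R. z - r) has_field_derivative (\<Prod>r\<in>R. z - r) * (\<Sum>r\<in>R. 1 / (z - r))) (at z)"
    if "finite R" "z \<notin> R" for R
    using that
  proof (induction R rule: finite_induct)
    case (insert r R)
    have "((\<lambda>z. (z - r) * (\<Prod>r\<in>R. z - r)) has_field_derivative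
        1 * (\<Prod>r\<in>R. z - r) + (\<Prod>r\<in>R. z - r) * (\<Sum>r\<in>R. 1 / (z - r)) * (z - r)) (at z)"
      using insert by (intro DERIV_mult insert.IH) (auto intro!: derivative_eq_intros)
    moreover have "1 * (\<Prod>r\<in>R. z - r) + (\<Prod>r\<in>R. z - r) * (\<Sum>r\<in>R. 1 / (z - r)) * (z - r) =
        (\<Prod>r\<in>insert r R. z - r) * (\<Sum>r\<in>insert r R. 1 / (z - r))"
    proof -
      have "1 * P + P * S * d = (d * P) * (1 / d + S)" if "d \<noteq> 0" for P S d :: complex
        using that by (simp add: field_simps)
      then show ?thesis using insert by simp
    qed
    ultimately show ?case using insert.hyps by simp
  qed simp
  define R where "R = {r. cpoly p r = 0}"
  have R: "finite R" "z \<notin> R" using finite_cpoly_roots[OF p] z by (auto simp: R_def)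
  have e: "cpoly p = (\<lambda>z. c * (\<Prod>r\<in>R. z - r))" unfolding R_def by (rule ext) (rule c(2))
  have "((\<lambda>z. c * (\<Prod>r\<in>R. z - r)) has_field_derivative c * ((\<Prod>r\<in>R. z - r) * (\<Sum>r\<in>R. 1 / (z - r)))) (at z)"
    by (intro DERIV_cmult D R)
  then have "(cpoly p has_field_derivative cpoly p z * (\<Sum>r\<in>R. 1 / (z - r))) (at z)"
    unfolding e mult.assoc .
  from DERIV_unique[OF cpoly_deriv this] z show ?thesis by (simp add: R_def)
qed

lemma cpoly_log_deriv2:
  assumes p: "p \<noteq> 0" and deg: "degree p \<le> card {z. cpoly p z = 0}" and z: "cpoly p z \<noteq> 0"
  shows "cpoly (pderiv (pderiv p)) z / cpoly p z - (cpoly (pderiv p) z / cpoly p z)\<^sup>2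
     = - (\<Sum>r | cpoly p r = 0. 1 / (z - r)\<^sup>2)"
proof -
  let ?R = "{r. cpoly p r = 0}"
  have "((\<lambda>z. \<Sum>r\<in>?R. 1 / (z - r)) has_field_derivative (\<Sum>r\<in>?R. - (1 / (z - r)\<^sup>2))) (at z)"
    using z by (intro DERIV_sum) (auto intro!: derivative_eq_intros simp: power2_eq_square)
  moreover have "((\<lambda>z. cpoly (pderiv p) z / cpoly p z) has_field_derivative
      (cpoly (pderiv (pderiv p)) z / cpoly p z - (cpoly (pderiv p) z / cpoly p z)\<^sup>2)) (at z)"
    using z by (auto intro!: derivative_eq_intros cpoly_deriv simp: field_simps power2_eq_square)
  then have "((\<lambda>z. \<Sum>r\<in>?R. 1 / (z - r)) has_field_derivative
      (cpoly (pderiv (pderiv p)) z / cpoly p z - (cpoly (pderiv p) z / cpoly p z)\<^sup>2)) (at z)"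
    by (rule has_field_derivative_transform_within_open[where S = "- ?R"])
      (use z cpoly_log_deriv[OF p deg] in \<open>auto intro!: open_Compl finite_imp_closed finite_cpoly_roots p\<close>)
  ultimately show ?thesis by (auto dest: DERIV_unique simp: sum_negf)
qed

lemma hermite_wr_nonzero: "hermite_wr \<nu> \<noteq> 0"
  using hermite_wr_pos[of \<nu> 0] by auto

lemma Im_root_hermite_wr: "cpoly (hermite_wr \<nu>) z = 0 \<Longrightarrow> Im z \<noteq> 0"
  using cpoly_of_real[of "hermite_wr \<nu>" "Re z"] hermite_wr_pos[of \<nu> "Re z"]
  by (metis complex_is_Real_iff of_real_Re of_real_eq_0_iff less_irrefl)

text \<open>\<open>W' = 2 z W - 2 f g\<close>, and \<open>f g\<close> has no zero off the real axis: the zeros of \<open>W\<close> are simple.\<close>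
lemma hermite_wr_deriv_at_root:
  assumes "cpoly (hermite_wr \<nu>) z = 0"
  shows "cpoly (pderiv (hermite_wr \<nu>)) z \<noteq> 0"
  using assms cpoly_hermite_nonzero[OF Im_root_hermite_wr[OF assms]]
  by (simp add: cpoly_pderiv_hermite_wr del: hermite.simps)

lemma card_roots_hermite_wr: "card {z. cpoly (hermite_wr \<nu>) z = 0} = 2 * \<nu>"
proof -
  let ?P = "map_poly complex_of_real (hermite_wr \<nu>)"
  have P: "?P \<noteq> 0" using hermite_wr_nonzero by (simp add: map_poly_eq_0_iff)
  have "poly (pderiv ?P) z = cpoly (pderiv (hermite_wr \<nu>)) z" for z
  proof (rule DERIV_unique[OF poly_DERIV])
    show "(poly ?P has_field_derivative cpoly (pderiv (hermite_wr \<nu>)) z) (at z)"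
      using cpoly_deriv[of "hermite_wr \<nu>" z UNIV] unfolding cpoly_def[abs_def] .
  qed
  then have "rsquarefree ?P"
    unfolding rsquarefree_roots using hermite_wr_deriv_at_root by (auto simp: cpoly_def[of "hermite_wr \<nu>"])
  then show ?thesis using rsquarefree_card_degree[OF P] by (simp add: cpoly_def degree_cpoly
      degree_hermite_wr)
qed

text \<open>The derivative of \<open>z + H'/H\<close>, that is, minus one half of the second derivative of
  \<open>- z\<^sup>2 - 2 log H\<close>, whose real part is the logarithm of the weight.\<close>
definition curv :: "real poly \<Rightarrow> complex \<Rightarrow> complex" where
  "curv H z = 1 + cpoly (pderiv (pderiv H)) z / cpoly H z - (cpoly (pderiv H) z / cpoly H z)\<^sup>2"

lemma curv_hermite_wr:
  "cpoly (hermite_wr \<nu>) z \<noteq> 0 \<Longrightarrow> curv (hermite_wr \<nu>) z = 1 - (\<Sum>r | cpoly (hermite_wr \<nu>) r = 0. 1 / (z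
      - r)\<^sup>2)"
  using cpoly_log_deriv2[OF hermite_wr_nonzero, of \<nu> z] by (simp add: curv_def card_roots_hermite_wr
      degree_hermite_wr algebra_simps)

section \<open>The exceptional zeros for large degree\<close>

lemma cpoly_exc:
  "cpoly (exc \<nu> N) z = 2 * (cpoly (hermite \<nu>) z * cpoly (hermite (Suc \<nu>)) z) * cpoly (pderiv (hermite N)) z
     + (cpoly (exc_rest \<nu>) z - 2 * of_nat N * cpoly (hermite_wr \<nu>) z) * cpoly (hermite N) z"
  by (simp add: exc_eq del: hermite.simps)

text \<open>The limits are taken jointly as \<open>N\<close> tends to infinity and the point to \<open>\<zeta>\<close>, since they are applied at
  zeros that move with \<open>N\<close>.\<close>
lemma hermite_logderiv_limits:
  assumes \<zeta>: "Im \<zeta> \<noteq> 0"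
  defines "F \<equiv> sequentially \<times>\<^sub>F nhds \<zeta>"
  shows "((\<lambda>(N, u). (hermite_logderiv N u)\<^sup>2 / of_nat N) \<longlongrightarrow> - 2) F"
    and "((\<lambda>(N, u). hermite_logderiv N u / of_nat N) \<longlongrightarrow> 0) F"
proof -
  define M where "M = 2 * (cmod \<zeta> + 1) + 1 / (\<bar>Im \<zeta>\<bar> / 2)"
  have N: "filterlim fst sequentially F" and u: "filterlim snd (nhds \<zeta>) F"
    unfolding F_def by (rule filterlim_fst filterlim_snd)+
  have "((\<lambda>u. 2 * cmod u + 1 / \<bar>Im u\<bar>) \<longlongrightarrow> 2 * cmod \<zeta> + 1 / \<bar>Im \<zeta>\<bar>) (nhds \<zeta>)"
    using \<zeta> by (auto intro!: tendsto_eq_intros filterlim_ident)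
  moreover have "2 * cmod \<zeta> + 1 / \<bar>Im \<zeta>\<bar> < M" using \<zeta> by (simp add: M_def field_simps add_pos_nonneg)
  ultimately have "\<forall>\<^sub>F u in nhds \<zeta>. 2 * cmod u + 1 / \<bar>Im u\<bar> < M"
    by (rule order_tendstoD)
  moreover have "\<forall>\<^sub>F u in nhds \<zeta>. Im u \<noteq> 0"
    by (rule tendsto_imp_eventually_ne[OF _ \<zeta>]) (auto intro!: tendsto_eq_intros filterlim_ident)
  ultimately have "\<forall>\<^sub>F u in nhds \<zeta>. Im u \<noteq> 0 \<and> 2 * cmod u + 1 / \<bar>Im u\<bar> \<le> M"
    by eventually_elim simp
  from eventually_compose_filterlim[OF this u]
  have u_ev: "\<forall>\<^sub>F x in F. Im (snd x) \<noteq> 0 \<and> 2 * cmod (snd x) + 1 / \<bar>Im (snd x)\<bar> \<le> M" .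
  have N_ev: "\<forall>\<^sub>F x in F. fst x > 0"
    using eventually_compose_filterlim[OF eventually_gt_at_top[of 0] N] .
  have "(\<lambda>N. M * (M + sqrt (2 * real N)) / real N) \<longlonglongrightarrow> 0" "(\<lambda>N. (M + sqrt (2 * real N)) / real N) \<longlonglongrightarrow> 0"
    by real_asymp+
  from filterlim_compose[OF this(1) N] filterlim_compose[OF this(2) N]
  have lim: "((\<lambda>x. M * (M + sqrt (2 * real (fst x))) / real (fst x)) \<longlongrightarrow> 0) F"
    "((\<lambda>x. (M + sqrt (2 * real (fst x))) / real (fst x)) \<longlongrightarrow> 0) F" .
  have "((\<lambda>x. (hermite_logderiv (fst x) (snd x))\<^sup>2 / of_nat (fst x) + 2) \<longlongrightarrow> 0) F"
  proof (rule Lim_null_comparison[OF _ lim(1)])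
    show "\<forall>\<^sub>F x in F. norm ((hermite_logderiv (fst x) (snd x))\<^sup>2 / of_nat (fst x) + 2)
        \<le> M * (M + sqrt (2 * real (fst x))) / real (fst x)"
      using u_ev N_ev
    proof eventually_elim
      case (elim x)
      have "(hermite_logderiv (fst x) (snd x))\<^sup>2 / of_nat (fst x) + 2 =
          ((hermite_logderiv (fst x) (snd x))\<^sup>2 + 2 * of_nat (fst x)) / of_nat (fst x)"
        using elim by (simp add: field_simps)
      then show ?case
        using hermite_logderiv_bounds(2)[of "snd x" M "fst x"] elim by (simp add: norm_divide
            divide_right_mono)
    qed
  qed
  from tendsto_diff[OF this tendsto_const[of 2]]
  show "((\<lambda>(N, u). (hermite_logderiv N u)\<^sup>2 / of_nat N) \<longlongrightarrow> - 2) F" by (simp add: case_prod_unfold)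
  have "((\<lambda>x. hermite_logderiv (fst x) (snd x) / of_nat (fst x)) \<longlongrightarrow> 0) F"
  proof (rule Lim_null_comparison[OF _ lim(2)])
    show "\<forall>\<^sub>F x in F. norm (hermite_logderiv (fst x) (snd x) / of_nat (fst x))
        \<le> (M + sqrt (2 * real (fst x))) / real (fst x)"
      using u_ev
      by eventually_elim (simp add: norm_divide divide_right_mono hermite_logderiv_bounds(1))
  qed
  then show "((\<lambda>(N, u). hermite_logderiv N u / of_nat N) \<longlongrightarrow> 0) F" by (simp add: case_prod_unfold)
qed

text \<open>At a non-real zero of \<open>P\<close> the equation \<open>2 N W = 2 s q + U\<close> with \<open>s = f g\<close> reads \<open>W = s E / N\<close> for
  \<open>E = q + U/(2 s)\<close>, which expresses \<open>W'/W\<close> and \<open>W''/W\<close> through \<open>E\<close>.\<close>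
lemma curv_at_exc_root:
  assumes u: "Im u \<noteq> 0" and root: "cpoly (exc \<nu> N) u = 0" and N: "N > 0"
  defines "s \<equiv> cpoly (hermite \<nu> * hermite (Suc \<nu>)) u"
    and "s' \<equiv> cpoly (pderiv (hermite \<nu> * hermite (Suc \<nu>))) u"
  defines "E \<equiv> hermite_logderiv N u + cpoly (exc_rest \<nu>) u / (2 * s)"
  assumes E: "E \<noteq> 0"
  shows "cpoly (hermite_wr \<nu>) u \<noteq> 0"
    and "curv (hermite_wr \<nu>) u / of_nat N = 1 / of_nat N + (2 / of_nat N + 2 * u * (2 * u / of_nat N
        - 2 / E) - 2 * (s' / s) / E)
       - (4 * u\<^sup>2 / of_nat N - 8 * u / E + 4 * (of_nat N / E\<^sup>2))"
proof -
  define W W' W'' where "W = cpoly (hermite_wr \<nu>) u" and "W' = cpoly (pderiv (hermite_wr \<nu>)) u"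
    and "W'' = cpoly (pderiv (pderiv (hermite_wr \<nu>))) u"
  have y: "cpoly (hermite N) u \<noteq> 0" and s: "s \<noteq> 0"
    using cpoly_hermite_nonzero[OF u] by (simp_all add: s_def del: hermite.simps)
  have "2 * s * hermite_logderiv N u + (cpoly (exc_rest \<nu>) u - 2 * of_nat N * W) = cpoly (exc \<nu> N) u
      / cpoly (hermite N) u"
    unfolding cpoly_exc hermite_logderiv_def s_def W_def using y by (simp add: field_simps del:
        hermite.simps)
  also have "\<dots> = 0" by (simp add: root)
  finally have "2 * of_nat N * W = 2 * s * E" using s by (simp add: E_def field_simps)
  then have W: "W = s * E / of_nat N" using N by (simp add: field_simps)
  then show W0: "cpoly (hermite_wr \<nu>) u \<noteq> 0" using s E N by (simp add: W_def)
  note p = pderiv_hermite_wr[of \<nu>]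
  have W': "W' = 2 * u * W - 2 * s" unfolding W'_def W_def s_def p by (simp del: hermite.simps)
  have "W'' = 2 * W + 2 * u * W' - 2 * s'"
    unfolding W''_def W'_def W_def s'_def by (subst p) (simp add: pderiv_diff pderiv_smult
        pderiv_mult[of "[:0,2:]"] pderiv_pCons del: hermite.simps mult_pCons_left)
  then have "W'' / W = 2 + 2 * u * (W' / W) - 2 * s' / W"
    using W0[folded W_def] by (simp add: add_divide_distrib diff_divide_distrib)
  moreover have W'W: "W' / W = 2 * u - 2 * of_nat N / E"
    unfolding W' using W0[folded W_def] s E N by (simp add: diff_divide_distrib) (simp add: W field_simps)
  moreover have "2 * s' / W = of_nat N * (2 * (s' / s) / E)" using s N E by (simp add: W field_simps)
  ultimately have c: "curv (hermite_wr \<nu>) u = 1 + (2 + 2 * u * (2 * u - 2 * of_nat N / E) - of_nat N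
      * (2 * (s' / s) / E))
      - (2 * u - 2 * of_nat N / E)\<^sup>2"
    by (simp only: curv_def W_def[symmetric] W'_def[symmetric] W''_def[symmetric])
  show "curv (hermite_wr \<nu>) u / of_nat N = 1 / of_nat N + (2 / of_nat N + 2 * u * (2 * u / of_nat N
      - 2 / E) - 2 * (s' / s) / E)
       - (4 * u\<^sup>2 / of_nat N - 8 * u / E + 4 * (of_nat N / E\<^sup>2))"
  proof -
    have gen: "(1 + (2 + 2 * u * (2 * u - 2 * k * j) - k * (2 * \<sigma> * j)) - (2 * u - 2 * k * j)\<^sup>2) / k =
        1 / k + (2 / k + 2 * u * (2 * u / k - 2 * j) - 2 * \<sigma> * j) - (4 * u\<^sup>2 / k - 8 * u * j + 4 *
            (k * j\<^sup>2))"
      if "k \<noteq> 0" for k j \<sigma> :: complex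
      using that by (simp add: field_simps power2_eq_square)
    show ?thesis
      unfolding c using gen[of "of_nat N" "1 / E" "s' / s"] N by (simp add: power_one_over)
  qed
qed

text \<open>Here \<open>E\<^sup>2/N\<close> tends to \<open>-2\<close>, so that in the preceding formula only the last term \<open>-4 N/E\<^sup>2\<close> survives.\<close>
lemma curv_at_exc_roots_limit:
  assumes \<zeta>: "Im \<zeta> \<noteq> 0" and \<epsilon>: "\<epsilon> > 0"
  shows "\<forall>\<^sub>F (N, u) in sequentially \<times>\<^sub>F nhds \<zeta>. cpoly (exc \<nu> N) u = 0 \<longrightarrow>
     cpoly (hermite_wr \<nu>) u \<noteq> 0 \<and> cmod (curv (hermite_wr \<nu>) u - 2 * of_nat N) \<le> \<epsilon> * real N"
proof -
  define F where "F = sequentially \<times>\<^sub>F nhds \<zeta>"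
  define s s' where "s = cpoly (hermite \<nu> * hermite (Suc \<nu>))" and "s' = cpoly (pderiv (hermite \<nu> *
      hermite (Suc \<nu>)))"
  define e where "e = (\<lambda>u. cpoly (exc_rest \<nu>) u / (2 * s u))"
  define E where "E = (\<lambda>x. hermite_logderiv (fst x) (snd x) + e (snd x))"
  have N: "filterlim fst sequentially F" and u: "(snd \<longlongrightarrow> \<zeta>) F"
    unfolding F_def by (rule filterlim_fst filterlim_snd)+
  have s0: "s \<zeta> \<noteq> 0" using cpoly_hermite_nonzero[OF \<zeta>] by (simp add: s_def del: hermite.simps)
  have s: "((\<lambda>x. s (snd x)) \<longlongrightarrow> s \<zeta>) F" "((\<lambda>x. s' (snd x)) \<longlongrightarrow> s' \<zeta>) F"
    unfolding s_def s'_def by (intro tendsto_cpoly u)+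
  have e: "((\<lambda>x. e (snd x)) \<longlongrightarrow> e \<zeta>) F"
    unfolding e_def using s0 by (intro tendsto_intros s u) auto
  have "(\<lambda>N. 1 / complex_of_nat N) \<longlonglongrightarrow> 0" by (rule lim_1_over_n)
  from filterlim_compose[OF this N] have invN: "((\<lambda>x. 1 / complex_of_nat (fst x)) \<longlongrightarrow> 0) F" .
  have q2: "((\<lambda>x. (hermite_logderiv (fst x) (snd x))\<^sup>2 / of_nat (fst x)) \<longlongrightarrow> - 2) F"
    and q1: "((\<lambda>x. hermite_logderiv (fst x) (snd x) / of_nat (fst x)) \<longlongrightarrow> 0) F"
    using hermite_logderiv_limits[OF \<zeta>] by (simp_all add: F_def case_prod_unfold)
  have "((\<lambda>x. (hermite_logderiv (fst x) (snd x))\<^sup>2 / of_nat (fst x) + 2 * (hermite_logderiv (fst x)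
      (snd x) / of_nat (fst x)) * e (snd x)
      + (e (snd x))\<^sup>2 * (1 / of_nat (fst x))) \<longlongrightarrow> - 2 + 2 * 0 * e \<zeta> + (e \<zeta>)\<^sup>2 * 0) F"
    by (intro tendsto_intros q1 q2 e invN)
  then have E2: "((\<lambda>x. (E x)\<^sup>2 / of_nat (fst x)) \<longlongrightarrow> - 2) F"
    by (simp add: E_def power2_sum add_divide_distrib add.commute add.left_commute
        mult.commute mult.left_commute)
  have "((\<lambda>x. hermite_logderiv (fst x) (snd x) / of_nat (fst x) + e (snd x) * (1 / of_nat (fst x)))
      \<longlongrightarrow> 0 + e \<zeta> * 0) F"
    by (intro tendsto_intros q1 e invN)
  then have E1: "((\<lambda>x. E x / of_nat (fst x)) \<longlongrightarrow> 0) F"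
    by (simp add: E_def add_divide_distrib)
  have N_E2: "((\<lambda>x. of_nat (fst x) / (E x)\<^sup>2) \<longlongrightarrow> - 1 / 2) F"
    using tendsto_inverse[OF E2] by simp
  have N_ev: "\<forall>\<^sub>F x in F. fst x > 0"
    using eventually_compose_filterlim[OF eventually_gt_at_top[of 0] N] .
  have E_ev: "\<forall>\<^sub>F x in F. E x \<noteq> 0"
    using tendsto_imp_eventually_ne[OF E2, of 0] by (auto elim!: eventually_mono)
  have u_ev: "\<forall>\<^sub>F x in F. Im (snd x) \<noteq> 0"
    by (rule tendsto_imp_eventually_ne[OF tendsto_Im[OF u] \<zeta>])
  have "((\<lambda>x. E x / of_nat (fst x) * (of_nat (fst x) / (E x)\<^sup>2)) \<longlongrightarrow> 0 * (- 1 / 2)) F"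
    by (intro tendsto_intros E1 N_E2)
  moreover have "\<forall>\<^sub>F x in F. E x / of_nat (fst x) * (of_nat (fst x) / (E x)\<^sup>2) = 1 / E x"
    using N_ev E_ev by eventually_elim (simp add: power2_eq_square)
  ultimately have invE: "((\<lambda>x. 1 / E x) \<longlongrightarrow> 0) F"
    by (simp add: tendsto_cong)
  let ?R = "\<lambda>x. 1 / of_nat (fst x) + (2 * (1 / of_nat (fst x)) + 2 * snd x * (2 * snd x * (1 /
      of_nat (fst x)) - 2 * (1 / E x))
       - 2 * (s' (snd x) / s (snd x)) * (1 / E x))
       - (4 * (snd x)\<^sup>2 * (1 / of_nat (fst x)) - 8 * snd x * (1 / E x) + 4 * (of_nat (fst x) / (E x)\<^sup>2))"
  have "(?R \<longlongrightarrow> 0 + (2 * 0 + 2 * \<zeta> * (2 * \<zeta> * 0 - 2 * 0) - 2 * (s' \<zeta> / s \<zeta>) * 0)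
      - (4 * \<zeta>\<^sup>2 * 0 - 8 * \<zeta> * 0 + 4 * (- 1 / 2))) F"
    using s0 by (intro tendsto_intros s u invN invE N_E2)
  then have "(?R \<longlongrightarrow> 2) F" by simp
  from tendstoD[OF this \<epsilon>] have "\<forall>\<^sub>F x in F. cmod (?R x - 2) < \<epsilon>" by (simp add: dist_norm)
  then have "\<forall>\<^sub>F x in F. cpoly (exc \<nu> (fst x)) (snd x) = 0 \<longrightarrow>
     cpoly (hermite_wr \<nu>) (snd x) \<noteq> 0 \<and> cmod (curv (hermite_wr \<nu>) (snd x) - 2 * of_nat (fst x)) \<le> \<epsilon>
         * real (fst x)"
    using N_ev E_ev u_ev
  proof eventually_elim
    case (elim x)
    show ?case
    proof (intro impI conjI)
      assume root: "cpoly (exc \<nu> (fst x)) (snd x) = 0"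
      note c = curv_at_exc_root[OF \<open>Im (snd x) \<noteq> 0\<close> root \<open>fst x > 0\<close> \<open>E x \<noteq> 0\<close>[unfolded E_def e_def s_def]]
      show "cpoly (hermite_wr \<nu>) (snd x) \<noteq> 0" by (rule c(1))
      have "curv (hermite_wr \<nu>) (snd x) / of_nat (fst x) = ?R x"
        unfolding c(2) E_def e_def s_def s'_def by simp
      then have "cmod (curv (hermite_wr \<nu>) (snd x) / of_nat (fst x) - 2) < \<epsilon>" using elim by simp
      then have "real (fst x) * cmod (curv (hermite_wr \<nu>) (snd x) / of_nat (fst x) - 2) \<le> real (fst x) * \<epsilon>"
        by (intro mult_left_mono) auto
      moreover have "curv (hermite_wr \<nu>) (snd x) - 2 * of_nat (fst x) = of_nat (fst x) * (curv
          (hermite_wr \<nu>) (snd x) / of_nat (fst x) - 2)"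
        using elim by (simp add: field_simps)
      ultimately show "cmod (curv (hermite_wr \<nu>) (snd x) - 2 * of_nat (fst x)) \<le> \<epsilon> * real (fst x)"
        by (simp only: norm_mult norm_of_nat mult.commute[of \<epsilon>])
    qed
  qed
  then show ?thesis by (simp add: F_def case_prod_unfold)
qed

lemma holomorphic_hermite_logderiv:
  assumes "\<And>u. u \<in> S \<Longrightarrow> Im u \<noteq> 0"
  shows "hermite_logderiv N holomorphic_on S"
  unfolding hermite_logderiv_def[abs_def] using cpoly_hermite_nonzero assms
  by (intro holomorphic_intros) auto

text \<open>The left-hand side is a perturbation of \<open>W\<close> of order \<open>1/\<surd>N\<close>, and off the real axis it has the same
  zeros as \<open>P\<close>.\<close>
lemma exc_quotient:
  assumes "Im u \<noteq> 0" "N > 0"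
  shows "cpoly (hermite_wr \<nu>) u - cpoly (exc_rest \<nu>) u / (2 * of_nat N)
      - cpoly (hermite \<nu> * hermite (Suc \<nu>)) u * (hermite_logderiv N u / of_nat N)
     = - (cpoly (exc \<nu> N) u / (2 * of_nat N * cpoly (hermite N) u))"
  unfolding cpoly_exc hermite_logderiv_def using cpoly_hermite_nonzero[OF assms(1)] assms(2)
  by (simp add: field_simps del: hermite.simps)

text \<open>Hurwitz's theorem applied to \<open>- P/(2 N y)\<close>, which converges to \<open>W\<close> locally uniformly off the
    real axis.\<close>
lemma exc_root_near:
  assumes root: "cpoly (hermite_wr \<nu>) \<zeta> = 0" and \<epsilon>: "\<epsilon> > 0"
  shows "\<forall>\<^sub>F N in sequentially. \<exists>u. cpoly (exc \<nu> N) u = 0 \<and> cmod (u - \<zeta>) < \<epsilon>"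
proof (rule ccontr)
  assume neg: "\<not> ?thesis"
  have \<zeta>: "Im \<zeta> \<noteq> 0" by (rule Im_root_hermite_wr[OF root])
  define \<delta> where "\<delta> = min \<epsilon> (\<bar>Im \<zeta>\<bar> / 2)"
  have \<delta>: "\<delta> > 0" "\<delta> \<le> \<epsilon>" "\<delta> \<le> \<bar>Im \<zeta>\<bar> / 2" using \<zeta> \<epsilon> by (auto simp: \<delta>_def)
  define S where "S = ball \<zeta> \<delta>"
  define M where "M = 2 * (cmod \<zeta> + \<delta>) + 1 / (\<bar>Im \<zeta>\<bar> / 2)"
  have S: "Im u \<noteq> 0" "2 * cmod u + 1 / \<bar>Im u\<bar> \<le> M" if "u \<in> S" for u
  proof -
    have d: "cmod (u - \<zeta>) < \<delta>" using that by (simp add: S_def dist_norm norm_minus_commute)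
    have "\<bar>Im \<zeta>\<bar> \<le> \<bar>Im u\<bar> + \<bar>Im (u - \<zeta>)\<bar>" by simp
    then have i: "\<bar>Im u\<bar> \<ge> \<bar>Im \<zeta>\<bar> / 2" using abs_Im_le_cmod[of "u - \<zeta>"] d \<delta> by linarith
    then show "Im u \<noteq> 0" using \<zeta> by auto
    have "cmod u \<le> cmod \<zeta> + \<delta>" using norm_triangle_sub[of u \<zeta>] d by linarith
    then have "2 * cmod u \<le> 2 * (cmod \<zeta> + \<delta>)" by simp
    moreover have "1 / \<bar>Im u\<bar> \<le> 1 / (\<bar>Im \<zeta>\<bar> / 2)"
      using i \<zeta> by (intro divide_left_mono) auto
    ultimately show "2 * cmod u + 1 / \<bar>Im u\<bar> \<le> M" unfolding M_def by (rule add_mono)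
  qed
  have bd: "\<exists>B. \<forall>u\<in>S. cmod (cpoly p u) \<le> B" for p
  proof -
    have "bounded (cpoly p ` cball \<zeta> \<delta>)"
      by (intro compact_imp_bounded compact_continuous_image compact_cball
          holomorphic_on_imp_continuous_on holomorphic_cpoly)
    then obtain B where "\<forall>u\<in>cball \<zeta> \<delta>. cmod (cpoly p u) \<le> B" unfolding bounded_iff by auto
    then show ?thesis by (intro exI[of _ B]) (auto simp: S_def)
  qed
  obtain B1 where B1: "\<And>u. u \<in> S \<Longrightarrow> cmod (cpoly (exc_rest \<nu>) u) \<le> B1" using bd by blast
  obtain B2 where B2: "\<And>u. u \<in> S \<Longrightarrow> cmod (cpoly (hermite \<nu> * hermite (Suc \<nu>)) u) \<le> B2" using bd by blast
  define \<phi> where "\<phi> N u = cpoly (hermite_wr \<nu>) u - cpoly (exc_rest \<nu>) u / (2 * of_nat N)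
      - cpoly (hermite \<nu> * hermite (Suc \<nu>)) u * (hermite_logderiv N u / of_nat N)" for N u
  have close: "cmod (\<phi> N u - cpoly (hermite_wr \<nu>) u) \<le> B1 / (2 * real N) + B2 * ((M + sqrt (2 * real
      N)) / real N)"
    if "u \<in> S" for u N
  proof -
    have "\<phi> N u - cpoly (hermite_wr \<nu>) u = - (cpoly (exc_rest \<nu>) u / (2 * of_nat N)
      + cpoly (hermite \<nu> * hermite (Suc \<nu>)) u * (hermite_logderiv N u / of_nat N))" by (simp add: \<phi>_def)
    then have "cmod (\<phi> N u - cpoly (hermite_wr \<nu>) u) \<le> cmod (cpoly (exc_rest \<nu>) u) / (2 * real N)
      + cmod (cpoly (hermite \<nu> * hermite (Suc \<nu>)) u) * (cmod (hermite_logderiv N u) / real N)"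
      using norm_triangle_ineq[of "cpoly (exc_rest \<nu>) u / (2 * of_nat N)" "cpoly (hermite \<nu> *
          hermite (Suc \<nu>)) u * (hermite_logderiv N u / of_nat N)"]
      by (simp only: norm_minus_cancel norm_mult norm_divide norm_of_nat norm_numeral)
    also have "\<dots> \<le> B1 / (2 * real N) + B2 * ((M + sqrt (2 * real N)) / real N)"
      using B1[OF that] B2[OF that] hermite_logderiv_bounds(1)[OF S[OF that], of N]
      by (intro add_mono mult_mono divide_right_mono) (auto intro: order.trans[OF norm_ge_zero])
    finally show ?thesis .
  qed
  \<comment> \<open>along a subsequence of bad degrees the approximations have no zero near \<open>\<zeta>\<close>\<close>
  define I where "I = {N. N > 0 \<and> \<not> (\<exists>u. cpoly (exc \<nu> N) u = 0 \<and> cmod (u - \<zeta>) < \<epsilon>)}"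
  have "\<exists>N\<ge>k. N \<in> I" for k
  proof -
    obtain N where "N \<ge> Suc k" "\<not> (\<exists>u. cpoly (exc \<nu> N) u = 0 \<and> cmod (u - \<zeta>) < \<epsilon>)"
      using neg unfolding eventually_sequentially by blast
    then show ?thesis unfolding I_def by (intro exI[of _ N]) simp
  qed
  then have "infinite I" by (auto simp: infinite_nat_iff_unbounded_le)
  then obtain r :: "nat \<Rightarrow> nat" where r: "strict_mono r" "\<And>k. r k \<in> I"
    using infinite_enumerate[of I] by blast
  have nz: "\<phi> (r k) u \<noteq> 0" if "u \<in> S" for k u
  proof -
    have u: "cmod (u - \<zeta>) < \<epsilon>" using that \<delta> by (simp add: S_def dist_norm norm_minus_commute)
    then have "r k > 0" "cpoly (exc \<nu> (r k)) u \<noteq> 0" using r(2)[of k] by (auto simp: I_def)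
    then show ?thesis
      unfolding \<phi>_def exc_quotient[OF S(1)[OF that] \<open>r k > 0\<close>]
      using cpoly_hermite_nonzero[OF S(1)[OF that]] by simp
  qed
  have unif: "uniform_limit X (\<lambda>k. \<phi> (r k)) (cpoly (hermite_wr \<nu>)) sequentially" if "X \<subseteq> S" for X
  proof (rule uniform_limitI)
    fix e :: real assume e: "e > 0"
    have "(\<lambda>N. B1 / (2 * real N) + B2 * ((M + sqrt (2 * real N)) / real N)) \<longlonglongrightarrow> 0"
      by real_asymp
    from LIMSEQ_subseq_LIMSEQ[OF this r(1)]
    have "(\<lambda>k. B1 / (2 * real (r k)) + B2 * ((M + sqrt (2 * real (r k))) / real (r k))) \<longlonglongrightarrow> 0" by
        (simp add: o_def)
    from order_tendstoD(2)[OF this e]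
    show "\<forall>\<^sub>F k in sequentially. \<forall>u\<in>X. dist (\<phi> (r k) u) (cpoly (hermite_wr \<nu>) u) < e"
    proof eventually_elim
      case (elim k)
      show ?case
      proof
        fix u assume "u \<in> X"
        then have "u \<in> S" using that by auto
        from close[OF this, of "r k"] elim show "dist (\<phi> (r k) u) (cpoly (hermite_wr \<nu>) u) < e"
          unfolding dist_norm by (rule order.strict_trans1)
      qed
    qed
  qed
  have "cpoly (hermite_wr \<nu>) \<zeta> \<noteq> 0"
  proof (rule Hurwitz_no_zeros[of S "\<lambda>k. \<phi> (r k)" "cpoly (hermite_wr \<nu>)" \<zeta>])
    show "open S" "connected S" "\<zeta> \<in> S" using \<delta> by (auto simp: S_def)
    show "\<phi> (r k) holomorphic_on S" for k
      unfolding \<phi>_def[abs_def] using S(1) r(2)[of k] by (intro holomorphic_intros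
          holomorphic_hermite_logderiv) (auto simp: I_def)
    show "cpoly (hermite_wr \<nu>) holomorphic_on S" by (rule holomorphic_cpoly)
    show "uniform_limit X (\<lambda>k. \<phi> (r k)) (cpoly (hermite_wr \<nu>)) sequentially" if "compact X" "X \<subseteq> S" for X
      by (rule unif[OF that(2)])
    show "\<phi> (r k) u \<noteq> 0" if "u \<in> S" for k u by (rule nz[OF that])
    show "\<not> cpoly (hermite_wr \<nu>) constant_on S"
    proof
      assume "cpoly (hermite_wr \<nu>) constant_on S"
      then obtain c where c: "\<And>u. u \<in> S \<Longrightarrow> cpoly (hermite_wr \<nu>) u = c" unfolding constant_on_def by blast
      have "((\<lambda>_. c) has_field_derivative 0) (at \<zeta>)" by simp
      then have "(cpoly (hermite_wr \<nu>) has_field_derivative 0) (at \<zeta>)"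
      proof (rule has_field_derivative_transform_within_open)
        show "open S" "\<zeta> \<in> S" using \<delta> by (auto simp: S_def)
        show "c = cpoly (hermite_wr \<nu>) u" if "u \<in> S" for u using c[OF that] by (rule sym)
      qed
      from DERIV_unique[OF cpoly_deriv this] show False using hermite_wr_deriv_at_root[OF root] by simp
    qed
  qed
  then show False using root by simp
qed

text \<open>\<open>P = N y den\<close> and \<open>P' = N\<^sup>2 y num\<close> with \<open>den\<close> tending to \<open>-2 W(w)\<close> and \<open>num\<close> to \<open>0\<close>.\<close>
lemma exc_log_deriv_limit:
  assumes w: "Im w \<noteq> 0" and W: "cpoly (hermite_wr \<nu>) w \<noteq> 0"
  shows "(\<lambda>N. cpoly (pderiv (exc \<nu> N)) w / cpoly (exc \<nu> N) w / of_nat N) \<longlonglongrightarrow> 0"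
    and "\<forall>\<^sub>F N in sequentially. cpoly (exc \<nu> N) w \<noteq> 0"
proof -
  define s s' where "s = cpoly (hermite \<nu> * hermite (Suc \<nu>)) w"
    and "s' = cpoly (pderiv (hermite \<nu> * hermite (Suc \<nu>))) w"
  define U U' V V' where "U = cpoly (exc_rest \<nu>) w" and "U' = cpoly (pderiv (exc_rest \<nu>)) w"
    and "V = cpoly (hermite_wr \<nu>) w" and "V' = cpoly (pderiv (hermite_wr \<nu>)) w"
  have "filterlim (\<lambda>N. (N, w)) (sequentially \<times>\<^sub>F nhds w) sequentially"
    by (intro filterlim_Pair filterlim_ident tendsto_const)
  from filterlim_compose[OF hermite_logderiv_limits(2)[OF w] this]
  have q: "(\<lambda>N. hermite_logderiv N w / of_nat N) \<longlonglongrightarrow> 0" by simp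
  have invN: "(\<lambda>N. 1 / complex_of_nat N) \<longlonglongrightarrow> 0" by (rule lim_1_over_n)
  define den where "den N = 2 * s * (hermite_logderiv N w / of_nat N) + U * (1 / of_nat N) - 2 * V" for N
  define num where "num N = 2 * s' * (hermite_logderiv N w / of_nat N) * (1 / of_nat N)
      + 2 * s * (2 * w * (hermite_logderiv N w / of_nat N) * (1 / of_nat N) - 2 * (1 / of_nat N))
      + U' * (1 / of_nat N) * (1 / of_nat N) - 2 * V' * (1 / of_nat N)
      + (U * (1 / of_nat N) - 2 * V) * (hermite_logderiv N w / of_nat N)" for N
  have "den \<longlonglongrightarrow> 2 * s * 0 + U * 0 - 2 * V"
    unfolding den_def by (intro tendsto_intros q invN)
  then have den: "den \<longlonglongrightarrow> - 2 * V" by simp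
  have "num \<longlonglongrightarrow> 2 * s' * 0 * 0 + 2 * s * (2 * w * 0 * 0 - 2 * 0) + U' * 0 * 0 - 2 * V' * 0 + (U * 0 -
      2 * V) * 0"
    unfolding num_def by (intro tendsto_intros q invN)
  then have num: "num \<longlonglongrightarrow> 0" by simp
  have V: "- 2 * V \<noteq> 0" using W by (simp add: V_def)
  have pos: "\<forall>\<^sub>F N in sequentially. (N::nat) > 0" by (rule eventually_gt_at_top)
  have den_ev: "\<forall>\<^sub>F N in sequentially. den N \<noteq> 0"
    using tendsto_imp_eventually_ne[OF den V] .
  have exc_den: "cpoly (exc \<nu> N) w = of_nat N * cpoly (hermite N) w * den N" if "N > 0" for N
    unfolding cpoly_exc den_def hermite_logderiv_def s_def U_def V_def using that
        cpoly_hermite_nonzero[OF w, of N]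
    by (simp add: field_simps del: hermite.simps)
  show "\<forall>\<^sub>F N in sequentially. cpoly (exc \<nu> N) w \<noteq> 0"
    using den_ev pos by eventually_elim (simp add: exc_den cpoly_hermite_nonzero[OF w] del: hermite.simps)
  have exc_num: "cpoly (pderiv (exc \<nu> N)) w = of_nat N * of_nat N * cpoly (hermite N) w * num N" if
      "N > 0" for N
  proof -
    define y y' where "y = cpoly (hermite N) w" and "y' = cpoly (pderiv (hermite N)) w"
    have y: "y \<noteq> 0" using cpoly_hermite_nonzero[OF w] by (simp add: y_def)
    have "cpoly (pderiv (exc \<nu> N)) w = 2 * s' * y' + 2 * s * (2 * w * y' - 2 * of_nat N * y)
        + (U' - 2 * of_nat N * V') * y + (U - 2 * of_nat N * V) * y'"
    proof -
      have gen: "cpoly (pderiv (p1 * p2 + p3 * p4)) w = cpoly (pderiv p1) w * cpoly p2 w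
          + cpoly p1 w * cpoly (pderiv p2) w + cpoly (pderiv p3) w * cpoly p4 w
          + cpoly p3 w * cpoly (pderiv p4) w" for p1 p2 p3 p4
        by (simp add: pderiv_add pderiv_mult algebra_simps)
      show ?thesis
        unfolding exc_eq gen y_def y'_def s_def s'_def U_def U'_def V_def V'_def
            cpoly_hermite_ode[symmetric]
        by (simp add: pderiv_smult pderiv_diff del: hermite.simps)
    qed
    also have "\<dots> = of_nat N * of_nat N * y * num N"
      unfolding num_def hermite_logderiv_def y_def[symmetric] y'_def[symmetric] using that y by
          (simp add: field_simps)
    finally show ?thesis by (simp add: y_def)
  qed
  have "(\<lambda>N. num N / den N) \<longlonglongrightarrow> 0 / (- 2 * V)"
    by (intro tendsto_divide num den V)
  moreover have "\<forall>\<^sub>F N in sequentially. cpoly (pderiv (exc \<nu> N)) w / cpoly (exc \<nu> N) w / of_nat N =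
      num N / den N"
    using pos by eventually_elim (simp add: exc_den exc_num cpoly_hermite_nonzero[OF w] del: hermite.simps)
  ultimately show "(\<lambda>N. cpoly (pderiv (exc \<nu> N)) w / cpoly (exc \<nu> N) w / of_nat N) \<longlonglongrightarrow> 0"
    by (simp add: tendsto_cong)
qed

text \<open>If there are as many points in \<open>X\<close> as in \<open>Z\<close> and every point of \<open>Z\<close> has a close one in \<open>X\<close>, then this
  accounts for all of \<open>X\<close>.\<close>
lemma close_separated_bij:
  fixes Z X :: "complex set"
  assumes "finite Z" "finite X" "card Z = card X"
    and near: "\<And>\<zeta>. \<zeta> \<in> Z \<Longrightarrow> \<exists>u\<in>X. cmod (u - \<zeta>) < \<epsilon>"
    and sep: "\<And>\<zeta> \<zeta>'. \<zeta> \<in> Z \<Longrightarrow> \<zeta>' \<in> Z \<Longrightarrow> \<zeta> \<noteq> \<zeta>' \<Longrightarrow> 2 * \<epsilon> \<le> cmod (\<zeta> - \<zeta>')"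
  obtains \<sigma> where "bij_betw \<sigma> Z X" "\<And>\<zeta>. \<zeta> \<in> Z \<Longrightarrow> cmod (\<sigma> \<zeta> - \<zeta>) < \<epsilon>"
proof -
  obtain \<sigma> where \<sigma>: "\<And>\<zeta>. \<zeta> \<in> Z \<Longrightarrow> \<sigma> \<zeta> \<in> X \<and> cmod (\<sigma> \<zeta> - \<zeta>) < \<epsilon>" using near by metis
  have "inj_on \<sigma> Z"
  proof (rule inj_onI, rule ccontr)
    fix \<zeta> \<zeta>' assume *: "\<zeta> \<in> Z" "\<zeta>' \<in> Z" "\<sigma> \<zeta> = \<sigma> \<zeta>'" "\<zeta> \<noteq> \<zeta>'"
    have "cmod (\<zeta> - \<zeta>') \<le> cmod (\<sigma> \<zeta> - \<zeta>) + cmod (\<sigma> \<zeta>' - \<zeta>')"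
      using norm_triangle_ineq4[of "\<sigma> \<zeta> - \<zeta>'" "\<sigma> \<zeta> - \<zeta>"] *(3) by simp
    then show False using sep[OF *(1,2,4)] \<sigma>[OF *(1)] \<sigma>[OF *(2)] by linarith
  qed
  moreover have "\<sigma> ` Z \<subseteq> X" using \<sigma> by auto
  then have "\<sigma> ` Z = X"
    using card_image[OF \<open>inj_on \<sigma> Z\<close>] assms by (intro card_subset_eq) auto
  ultimately have "bij_betw \<sigma> Z X" by (simp add: bij_betw_def)
  then show ?thesis using that \<sigma> by blast
qed

section \<open>Second derivatives of the logarithmic energy\<close>

text \<open>The point that carries the \<open>j\<close>-th real variable; the \<open>m\<close> complex points come first.\<close>
definition coord_point :: "nat \<Rightarrow> nat \<Rightarrow> nat" where
  "coord_point m j = (if j < 2 * m then j div 2 else j - m)"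

text \<open>The direction in which that point moves: \<open>\<i>\<close> for the imaginary part of a complex point.\<close>
definition coord_dir :: "nat \<Rightarrow> nat \<Rightarrow> complex" where
  "coord_dir m j = (if j < 2 * m \<and> odd j then \<i> else 1)"

lemma all_points_upd:
  "all_points m (y(j := t)) k =
     all_points m y k + (if k = coord_point m j then of_real (t - y j) * coord_dir m j else 0)"
proof (cases "k < m")
  case True
  then show ?thesis
    by (auto simp: all_points_def cpoint_def coord_point_def coord_dir_def complex_eq_iff elim!: evenE oddE)
next
  case False
  then show ?thesis
    by (auto simp: all_points_def rpoint_def coord_point_def coord_dir_def)
qed

lemma log_energy_eq:
  "log_energy H m n y = (\<Sum>k<m + n. ln (weight H (all_points m y k)))
     + (\<Sum>l<m + n. \<Sum>k<l. ln ((cmod (all_points m y k - all_points m y l))\<^sup>2))"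
proof -
  have cross: "cmod (complex_of_real a - complex_of_real b) = \<bar>a - b\<bar>" for a b
    by (metis norm_of_real of_real_diff)
  show ?thesis
    unfolding log_energy_def
    by (simp add: sum_split_add all_points_def sum.distrib cross norm_minus_commute
          sum.swap[of _ "{..<m}" "{..<n}"] power2_commute)
qed

text \<open>A configuration at which the energy is finite and differentiable.\<close>
definition admissible :: "real poly \<Rightarrow> nat \<Rightarrow> nat \<Rightarrow> (nat \<Rightarrow> real) \<Rightarrow> bool" where
  "admissible H m n y \<longleftrightarrow> inj_on (all_points m y) {..<m + n} \<and>
     (\<forall>k<m + n. cpoly H (all_points m y k) \<noteq> 0)"

lemma admissible_upd:
  assumes "admissible H m n y"
  shows "\<forall>\<^sub>F t in nhds (y j). admissible H m n (y(j := t))"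
proof -
  let ?u = "\<lambda>t. all_points m (y(j := t))"
  have u: "((\<lambda>t. ?u t k) \<longlongrightarrow> all_points m y k) (nhds (y j))" for k
  proof -
    have *: "((\<lambda>t. complex_of_real (t - y j)) \<longlongrightarrow> 0) (nhds (y j))"
      by (auto intro!: tendsto_eq_intros filterlim_ident)
    show ?thesis
      unfolding all_points_upd
      using tendsto_add[OF tendsto_const tendsto_mult_left_zero[OF *, of "coord_dir m j"]]
      by (cases "k = coord_point m j") (simp_all del: of_real_diff)
  qed
  have 1: "\<forall>\<^sub>F t in nhds (y j). cpoly H (?u t k) \<noteq> 0" if "k < m + n" for k
    using tendsto_imp_eventually_ne[OF tendsto_cpoly[OF u]] assms that by (auto simp: admissible_def)
  have 2: "\<forall>\<^sub>F t in nhds (y j). ?u t k - ?u t l \<noteq> 0" if "k < m + n" "l < m + n" "k \<noteq> l" for k l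
    using tendsto_imp_eventually_ne[OF tendsto_diff[OF u[of k] u[of l]], of 0] assms that
    by (auto simp: admissible_def inj_on_def)
  have "\<forall>\<^sub>F t in nhds (y j). \<forall>k\<in>{..<m + n}. cpoly H (?u t k) \<noteq> 0 \<and>
      (\<forall>l\<in>{..<m + n}. k \<noteq> l \<longrightarrow> ?u t k - ?u t l \<noteq> 0)"
    using 1 2 by (intro eventually_ball_finite ballI eventually_conj) auto
  then show ?thesis
    by eventually_elim (auto simp: admissible_def inj_on_def)
qed

lemma ln_norm_sq_deriv:
  assumes g: "(g has_vector_derivative g') (at t)" and nz: "g t \<noteq> 0"
  shows "((\<lambda>t. ln ((cmod (g t))\<^sup>2)) has_real_derivative 2 * Re (g' / g t)) (at t)"
proof -
  have re: "((\<lambda>t. Re (g t)) has_real_derivative Re g') (at t)"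
    and im: "((\<lambda>t. Im (g t)) has_real_derivative Im g') (at t)"
    using bounded_linear.has_vector_derivative[OF bounded_linear_Re g]
      bounded_linear.has_vector_derivative[OF bounded_linear_Im g]
    by (simp_all add: has_real_derivative_iff_has_vector_derivative)
  have pos: "(Re (g t))\<^sup>2 + (Im (g t))\<^sup>2 > 0"
    using nz by (simp add: complex_eq_iff sum_power2_gt_zero_iff)
  have "((\<lambda>t. (Re (g t))\<^sup>2 + (Im (g t))\<^sup>2) has_real_derivative
      2 * (Re (g t) * Re g' + Im (g t) * Im g')) (at t)"
    by (rule DERIV_cong[OF DERIV_add[OF DERIV_power[OF re, of 2] DERIV_power[OF im, of 2]]]) simp
  from DERIV_chain2[OF DERIV_ln_divide[OF pos] this]
  have "((\<lambda>t. ln ((Re (g t))\<^sup>2 + (Im (g t))\<^sup>2)) has_real_derivative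
      1 / ((Re (g t))\<^sup>2 + (Im (g t))\<^sup>2) * (2 * (Re (g t) * Re g' + Im (g t) * Im g'))) (at t)" .
  then show ?thesis
    unfolding cmod_power2 by (rule DERIV_cong) (simp add: Re_divide algebra_simps add_divide_distrib)
qed

lemma ln_weight_deriv:
  assumes g: "(g has_vector_derivative g') (at t)" and nz: "cpoly H (g t) \<noteq> 0"
  shows "((\<lambda>t. ln (weight H (g t))) has_real_derivative
     Re (g' * (- 2 * g t - 2 * (cpoly (pderiv H) (g t) / cpoly H (g t))))) (at t)"
proof -
  have H: "((\<lambda>t. cpoly H (g t)) has_vector_derivative g' * cpoly (pderiv H) (g t)) (at t)"
    using field_vector_diff_chain_at[OF g cpoly_deriv] by (simp add: o_def)
  have sq: "((\<lambda>t. (g t)\<^sup>2) has_vector_derivative g' * (2 * g t)) (at t)"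
  proof -
    have "((\<lambda>z. z\<^sup>2) has_field_derivative 2 * g t) (at (g t))"
      by (auto intro!: derivative_eq_intros)
    from field_vector_diff_chain_at[OF g this] show ?thesis by (simp add: o_def)
  qed
  have re: "((\<lambda>t. Re ((g t)\<^sup>2)) has_real_derivative Re (g' * (2 * g t))) (at t)"
    using bounded_linear.has_vector_derivative[OF bounded_linear_Re sq]
    by (simp add: has_real_derivative_iff_has_vector_derivative)
  have "((\<lambda>t. - Re ((g t)\<^sup>2) - ln ((cmod (cpoly H (g t)))\<^sup>2)) has_real_derivative
     - Re (g' * (2 * g t)) - 2 * Re (g' * cpoly (pderiv H) (g t) / cpoly H (g t))) (at t)"
    by (intro derivative_intros re ln_norm_sq_deriv[OF H nz])
  also have "- Re (g' * (2 * g t)) - 2 * Re (g' * cpoly (pderiv H) (g t) / cpoly H (g t)) =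
     Re (g' * (- 2 * g t - 2 * (cpoly (pderiv H) (g t) / cpoly H (g t))))"
  proof -
    have "- Re (a * (2 * b)) - 2 * Re (a * c) = Re (a * (- 2 * b - 2 * c))" for a b c
      by (simp add: algebra_simps)
    then show ?thesis by (metis times_divide_eq_right)
  qed
  finally have D: "((\<lambda>t. - Re ((g t)\<^sup>2) - ln ((cmod (cpoly H (g t)))\<^sup>2)) has_real_derivative
     Re (g' * (- 2 * g t - 2 * (cpoly (pderiv H) (g t) / cpoly H (g t))))) (at t)" .
  have "isCont (\<lambda>t. cpoly H (g t)) t"
    by (rule has_vector_derivative_continuous[OF H])
  then have ev: "\<forall>\<^sub>F t in nhds t. cpoly H (g t) \<noteq> 0"
    unfolding eventually_nhds_conv_at isCont_def using nz by (auto intro: tendsto_imp_eventually_ne)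
  have "\<forall>\<^sub>F t in nhds t. ln (weight H (g t)) = - Re ((g t)\<^sup>2) - ln ((cmod (cpoly H (g t)))\<^sup>2)"
    using ev by eventually_elim (simp add: weight_def ln_div)
  then show ?thesis
    using D by (subst DERIV_cong_ev[OF refl _ refl])
qed

text \<open>The energy is the real part of a (multivalued) holomorphic function of the points; the next
  two definitions are the first and second complex derivatives of that function.\<close>
definition energy_grad :: "real poly \<Rightarrow> nat \<Rightarrow> (nat \<Rightarrow> complex) \<Rightarrow> nat \<Rightarrow> complex" where
  "energy_grad H N u p = - 2 * u p - 2 * (cpoly (pderiv H) (u p) / cpoly H (u p))
     + (\<Sum>l\<in>{..<N} - {p}. 2 / (u p - u l))"

definition energy_hess :: "real poly \<Rightarrow> nat \<Rightarrow> (nat \<Rightarrow> complex) \<Rightarrow> nat \<Rightarrow> nat \<Rightarrow> complex" where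
  "energy_hess H N u p q =
     (if p = q then - 2 * (1 + cpoly (pderiv (pderiv H)) (u p) / cpoly H (u p)
          - (cpoly (pderiv H) (u p) / cpoly H (u p))\<^sup>2)
        - (\<Sum>l\<in>{..<N} - {p}. 2 / (u p - u l)\<^sup>2)
      else 2 / (u p - u q)\<^sup>2)"

text \<open>The pairs that contain a given index \<open>p\<close>.\<close>
lemma sum_pairs_single:
  fixes g :: "nat \<Rightarrow> 'a :: comm_monoid_add"
  assumes "p < N"
  shows "(\<Sum>l<N. \<Sum>k<l. if k = p then g l else if l = p then g k else 0) = (\<Sum>l\<in>{..<N} - {p}. g l)"
proof -
  \<comment> \<open>for \<open>l > p\<close> only \<open>k = p\<close> contributes, for \<open>l = p\<close> every \<open>k < p\<close>, for \<open>l < p\<close> nothing\<close>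
  have in1: "(\<Sum>k<l. if k = p then g l else if l = p then g k else 0) =
     (if p < l then g l else 0) + (if l = p then \<Sum>k<p. g k else 0)" for l
  proof (cases "l = p")
    case True
    then show ?thesis by (auto intro!: sum.cong)
  next
    case False
    then have "(\<Sum>k<l. if k = p then g l else if l = p then g k else 0) = (\<Sum>k<l. if k = p then g l else 0)"
      by (intro sum.cong) auto
    then show ?thesis using False by simp
  qed
  have "(\<Sum>l<N. \<Sum>k<l. if k = p then g l else if l = p then g k else 0) =
     (\<Sum>l<N. if p < l then g l else 0) + (\<Sum>k<p. g k)"
    unfolding in1 sum.distrib using assms by simp
  also have "(\<Sum>l<N. if p < l then g l else 0) = (\<Sum>l\<in>{p<..<N}. g l)"
    by (intro sum.mono_neutral_cong_right) auto
  also have "\<dots> + (\<Sum>k<p. g k) = (\<Sum>l\<in>{p<..<N} \<union> {..<p}. g l)"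
    by (subst sum.union_disjoint) auto
  also have "{p<..<N} \<union> {..<p} = {..<N} - {p}" using assms by auto
  finally show ?thesis .
qed

lemma coord_point_less: "j < 2 * m + n \<Longrightarrow> coord_point m j < m + n"
  by (auto simp: coord_point_def)

lemma all_points_upd_deriv:
  "((\<lambda>t. all_points m (y(j := t)) k) has_vector_derivative (if k = coord_point m j then coord_dir m
      j else 0)) (at t)"
proof -
  have "((\<lambda>t. complex_of_real (t - y j) * coord_dir m j) has_vector_derivative coord_dir m j) (at t)"
    by (auto intro!: derivative_eq_intros)
  then show ?thesis unfolding all_points_upd
    by (auto intro!: derivative_eq_intros)
qed

lemma partial_deriv_log_energy:
  assumes adm: "admissible H m n y" and j: "j < 2 * m + n"
  shows "partial_deriv j (log_energy H m n) y = Re (coord_dir m j * energy_grad H (m + n)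
      (all_points m y) (coord_point m j))"
proof -
  let ?u = "all_points m y" and ?p = "coord_point m j" and ?d = "coord_dir m j"
  let ?e = "\<lambda>k :: nat. if k = ?p then ?d else 0"
  have u: "all_points m (y(j := y j)) = ?u" by simp
  have W: "((\<lambda>t. ln (weight H (all_points m (y(j := t)) k))) has_real_derivative
     Re (?e k * (- 2 * ?u k - 2 * (cpoly (pderiv H) (?u k) / cpoly H (?u k))))) (at (y j))"
    if "k < m + n" for k
    using ln_weight_deriv[OF all_points_upd_deriv, of H m y j "y j" k] adm that
    by (simp add: u admissible_def del: fun_upd_apply)
  have L: "((\<lambda>t. ln ((cmod (all_points m (y(j := t)) k - all_points m (y(j := t)) l))\<^sup>2))
      has_real_derivative
     2 * Re ((?e k - ?e l) / (?u k - ?u l))) (at (y j))" if "k < l" "l < m + n" for k l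
  proof -
    have "?u k - ?u l \<noteq> 0" using adm that by (auto simp: admissible_def inj_on_def)
    then show ?thesis
      using ln_norm_sq_deriv[OF has_vector_derivative_diff[OF all_points_upd_deriv[of m y j k "y j"]
        all_points_upd_deriv[of m y j l "y j"]], unfolded u] by blast
  qed
  have "((\<lambda>t. log_energy H m n (y(j := t))) has_real_derivative
     (\<Sum>k<m + n. Re (?e k * (- 2 * ?u k - 2 * (cpoly (pderiv H) (?u k) / cpoly H (?u k)))))
     + (\<Sum>l<m + n. \<Sum>k<l. 2 * Re ((?e k - ?e l) / (?u k - ?u l)))) (at (y j))"
    unfolding log_energy_eq by (intro DERIV_add DERIV_sum W L) auto
  also have "(\<Sum>k<m + n. Re (?e k * (- 2 * ?u k - 2 * (cpoly (pderiv H) (?u k) / cpoly H (?u k)))))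
     = (\<Sum>k<m + n. if k = ?p then Re (?d * (- 2 * ?u k - 2 * (cpoly (pderiv H) (?u k) / cpoly H (?u
         k)))) else 0)"
    by (intro sum.cong) auto
  also have "\<dots> = Re (?d * (- 2 * ?u ?p - 2 * (cpoly (pderiv H) (?u ?p) / cpoly H (?u ?p))))"
    using coord_point_less[OF j] by simp
  also have "(\<Sum>l<m + n. \<Sum>k<l. 2 * Re ((?e k - ?e l) / (?u k - ?u l))) =
     (\<Sum>l<m + n. \<Sum>k<l. if k = ?p then Re (?d * (2 / (?u ?p - ?u l)))
        else if l = ?p then Re (?d * (2 / (?u ?p - ?u k))) else 0)"
  proof (intro sum.cong refl)
    fix l k :: nat assume "k \<in> {..<l}"
    have two: "Re (a * (2 / b)) = 2 * Re (a / b)" for a b :: complex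
    proof -
      have "a * (2 / b) = a / b + a / b" by (cases "b = 0") (simp_all add: field_simps)
      then show ?thesis by (simp only: plus_complex.sel mult_2)
    qed
    have "- ?d / (?u k - ?u ?p) = ?d / (?u ?p - ?u k)" by (metis minus_diff_eq minus_divide_divide)
    then have "- Re (?d / (?u k - ?u ?p)) = Re (?d / (?u ?p - ?u k))"
      by (metis uminus_complex.sel(1) minus_divide_left)
    then show "2 * Re ((?e k - ?e l) / (?u k - ?u l)) = (if k = ?p then Re (?d * (2 / (?u ?p - ?u l)))
        else if l = ?p then Re (?d * (2 / (?u ?p - ?u k))) else 0)"
      unfolding two using \<open>k \<in> {..<l}\<close> by auto
  qed
  also have "\<dots> = (\<Sum>l\<in>{..<m + n} - {?p}. Re (?d * (2 / (?u ?p - ?u l))))"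
    by (rule sum_pairs_single[OF coord_point_less[OF j]])
  also have "Re (?d * (- 2 * ?u ?p - 2 * (cpoly (pderiv H) (?u ?p) / cpoly H (?u ?p)))) + \<dots> =
      Re (?d * energy_grad H (m + n) ?u ?p)"
    unfolding energy_grad_def distrib_left[of ?d] sum_distrib_left plus_complex.sel Re_sum ..
  finally show ?thesis
    unfolding partial_deriv_def by (rule DERIV_imp_deriv)
qed

lemma energy_grad_deriv:
  assumes adm: "admissible H m n y" and i: "i < 2 * m + n" and q: "q < m + n"
  shows "((\<lambda>t. energy_grad H (m + n) (all_points m (y(i := t))) q) has_vector_derivative
     coord_dir m i * energy_hess H (m + n) (all_points m y) q (coord_point m i)) (at (y i))"
proof -
  let ?u = "all_points m y" and ?p = "coord_point m i" and ?d = "coord_dir m i"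
  let ?e = "\<lambda>k :: nat. if k = ?p then ?d else 0"
  have u: "all_points m (y(i := y i)) = ?u" by simp
  have nz: "cpoly H (?u q) \<noteq> 0" using adm q by (auto simp: admissible_def)
  have D: "((\<lambda>z. - 2 * z - 2 * (cpoly (pderiv H) z / cpoly H z)) has_field_derivative
      - 2 * (1 + cpoly (pderiv (pderiv H)) (?u q) / cpoly H (?u q)
          - (cpoly (pderiv H) (?u q) / cpoly H (?u q))\<^sup>2)) (at (?u q))"
    using nz by (auto intro!: derivative_eq_intros cpoly_deriv simp: field_simps power2_eq_square)
  have 1: "((\<lambda>t. - 2 * all_points m (y(i := t)) q - 2 * (cpoly (pderiv H) (all_points m (y(i := t)) q) /
        cpoly H (all_points m (y(i := t)) q))) has_vector_derivative
      ?e q * (- 2 * (1 + cpoly (pderiv (pderiv H)) (?u q) / cpoly H (?u q)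
          - (cpoly (pderiv H) (?u q) / cpoly H (?u q))\<^sup>2))) (at (y i))"
    using field_vector_diff_chain_at[OF all_points_upd_deriv[of m y i q "y i"], unfolded u, OF D]
    by (simp add: o_def del: fun_upd_apply)
  have 2: "((\<lambda>t. 2 / (all_points m (y(i := t)) q - all_points m (y(i := t)) l)) has_vector_derivative
      (?e q - ?e l) * (- (2 / (?u q - ?u l)\<^sup>2))) (at (y i))" if "l \<in> {..<m + n} - {q}" for l
  proof -
    have ne: "?u q - ?u l \<noteq> 0" using adm q that by (auto simp: admissible_def inj_on_def)
    have "((\<lambda>z. 2 / z) has_field_derivative - (2 / (?u q - ?u l)\<^sup>2)) (at (?u q - ?u l))"
      using ne by (auto intro!: derivative_eq_intros simp: power2_eq_square)
    from field_vector_diff_chain_at[OF has_vector_derivative_diff[OF all_points_upd_deriv[of m y i q "y i"]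
        all_points_upd_deriv[of m y i l "y i"]], unfolded u, OF this]
    show ?thesis by (simp add: o_def del: fun_upd_apply)
  qed
  have "((\<lambda>t. energy_grad H (m + n) (all_points m (y(i := t))) q) has_vector_derivative
     ?e q * (- 2 * (1 + cpoly (pderiv (pderiv H)) (?u q) / cpoly H (?u q)
          - (cpoly (pderiv H) (?u q) / cpoly H (?u q))\<^sup>2))
      + (\<Sum>l\<in>{..<m + n} - {q}. (?e q - ?e l) * (- (2 / (?u q - ?u l)\<^sup>2)))) (at (y i))"
    unfolding energy_grad_def
    by (intro has_vector_derivative_add has_vector_derivative_sum 1 2)
  also have "?e q * (- 2 * (1 + cpoly (pderiv (pderiv H)) (?u q) / cpoly H (?u q)
          - (cpoly (pderiv H) (?u q) / cpoly H (?u q))\<^sup>2))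
      + (\<Sum>l\<in>{..<m + n} - {q}. (?e q - ?e l) * (- (2 / (?u q - ?u l)\<^sup>2))) =
     ?d * energy_hess H (m + n) ?u q ?p"
  proof (cases "q = ?p")
    case True
    have "(\<Sum>l\<in>{..<m + n} - {?p}. (?d - ?e l) * (- (2 / (?u ?p - ?u l)\<^sup>2))) =
        (\<Sum>l\<in>{..<m + n} - {?p}. - (?d * (2 / (?u ?p - ?u l)\<^sup>2)))"
      by (intro sum.cong) auto
    then show ?thesis
      by (simp add: True energy_hess_def sum_distrib_left sum_negf right_diff_distrib mult.left_commute)
  next
    case False
    have "(\<Sum>l\<in>{..<m + n} - {q}. (?e q - ?e l) * (- (2 / (?u q - ?u l)\<^sup>2))) =
        (\<Sum>l\<in>{..<m + n} - {q}. if l = ?p then ?d * (2 / (?u q - ?u ?p)\<^sup>2) else 0)"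
      using False by (intro sum.cong) auto
    also have "\<dots> = ?d * (2 / (?u q - ?u ?p)\<^sup>2)"
      using coord_point_less[OF i] False by simp
    finally show ?thesis using False by (simp add: energy_hess_def)
  qed
  finally show ?thesis .
qed

lemma hessian_log_energy:
  assumes adm: "admissible H m n y" and i: "i < 2 * m + n" and j: "j < 2 * m + n"
  shows "hessian (2 * m + n) (log_energy H m n) y $$ (i, j) =
     Re (coord_dir m i * coord_dir m j * energy_hess H (m + n) (all_points m y) (coord_point m j)
         (coord_point m i))"
proof -
  let ?g = "\<lambda>t. coord_dir m j * energy_grad H (m + n) (all_points m (y(i := t))) (coord_point m j)"
  have "((\<lambda>t. coord_dir m j * energy_grad H (m + n) (all_points m (y(i := t))) (coord_point m j))
      has_vector_derivative
      coord_dir m j * (coord_dir m i * energy_hess H (m + n) (all_points m y) (coord_point m j)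
          (coord_point m i))) (at (y i))"
    by (rule has_vector_derivative_mult_right[OF energy_grad_deriv[OF adm i coord_point_less[OF j]]])
  from bounded_linear.has_vector_derivative[OF bounded_linear_Re this]
  have "((\<lambda>t. Re (?g t)) has_real_derivative
      Re (coord_dir m i * coord_dir m j * energy_hess H (m + n) (all_points m y) (coord_point m j)
          (coord_point m i))) (at (y i))"
    by (simp add: has_real_derivative_iff_has_vector_derivative mult_ac)
  moreover have "\<forall>\<^sub>F t in nhds (y i). partial_deriv j (log_energy H m n) (y(i := t)) = Re (?g t)"
    using admissible_upd[OF adm, of i] by eventually_elim (rule partial_deriv_log_energy[OF _ j])
  ultimately have "((\<lambda>t. partial_deriv j (log_energy H m n) (y(i := t))) has_real_derivative
      Re (coord_dir m i * coord_dir m j * energy_hess H (m + n) (all_points m y) (coord_point m j)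
          (coord_point m i))) (at (y i))"
    by (subst DERIV_cong_ev[OF refl _ refl])
  then show ?thesis
    using i j unfolding hessian_def by (simp add: partial_deriv_def[of i] DERIV_imp_deriv)
qed

section \<open>Diagonal dominance of the scaled matrix\<close>

text \<open>Scaling multiplies the upper right block by \<open>K\<close> and the lower left block by \<open>1/K\<close>.\<close>
lemma diagonally_dominant_modified_hessian:
  assumes A: "A \<in> carrier_mat (2 * m + n) (2 * m + n)" and K: "K > 0"
    and row1: "\<And>r. r < 2 * m \<Longrightarrow>
      (\<Sum>c\<in>{..<2 * m} - {r}. \<bar>A $$ (r, c)\<bar>) + K * (\<Sum>i<n. \<bar>A $$ (r, 2 * m + i)\<bar>) \<le> \<bar>A $$ (r, r)\<bar>"
    and row2: "\<And>i. i < n \<Longrightarrow>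
      (\<Sum>c<2 * m. \<bar>A $$ (2 * m + i, c)\<bar>) / K + (\<Sum>j\<in>{..<n} - {i}. \<bar>A $$ (2 * m + i, 2 * m + j)\<bar>)
        \<le> \<bar>A $$ (2 * m + i, 2 * m + i)\<bar>"
  shows "diagonally_dominant (modified_hessian m n K A)"
proof -
  let ?d = "\<lambda>K i. if i < 2 * m then 1 else K :: real"
  have inv: "mat_inverse (scaling m n K) = Some (scaling m n (1 / K))"
    using K by (intro mat_inverse_scaling) simp
  have "modified_hessian m n K A = Matrix.mat (2 * m + n) (2 * m + n) (\<lambda>(r, c). ?d (1 / K) r * A $$
      (r, c)) * scaling m n K"
    unfolding modified_hessian_def inv option.sel unfolding scaling_def by (subst
        mat_diag_mult_left[OF A]) simp
  also have "\<dots> = Matrix.mat (2 * m + n) (2 * m + n) (\<lambda>(r, c). ?d (1 / K) r * A $$ (r, c) * ?d K c)"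
    unfolding scaling_def by (subst mat_diag_mult_right[of _ "2 * m + n"]) (auto intro!: eq_matI)
  finally have B: "modified_hessian m n K A = \<dots>" .
  have split: "(\<Sum>c\<in>{..<2 * m + n} - {r}. f c) =
      (\<Sum>c\<in>{..<2 * m} - {r}. f c) + (\<Sum>i\<in>{i. i < n \<and> 2 * m + i \<noteq> r}. f (2 * m + i))" for r and f ::
          "nat \<Rightarrow> real"
  proof -
    have "{..<2 * m + n} - {r} = ({..<2 * m} - {r}) \<union> (\<lambda>i. 2 * m + i) ` {i. i < n \<and> 2 * m + i \<noteq> r}"
      by (auto simp: image_iff) (metis add_less_cancel_left le_add_diff_inverse not_less)
    then show ?thesis
      by (subst \<open>{..<2 * m + n} - {r} = _\<close>, subst sum.union_disjoint) (auto simp: sum.reindex inj_on_def)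
  qed
  show ?thesis
    unfolding diagonally_dominant_def
  proof (intro conjI allI impI)
    show "square_mat (modified_hessian m n K A)" by (simp add: B)
    fix r assume "r < dim_row (modified_hessian m n K A)"
    then have r: "r < 2 * m + n" by (simp add: B)
    have e: "modified_hessian m n K A $$ (r, c) = ?d (1 / K) r * A $$ (r, c) * ?d K c" if "c < 2 * m
        + n" for c
      using r that by (simp add: B)
    have "(\<Sum>c\<in>{..<dim_col (modified_hessian m n K A)} - {r}. \<bar>modified_hessian m n K A $$ (r, c)\<bar>) =
       (\<Sum>c\<in>{..<2 * m} - {r}. \<bar>?d (1 / K) r * A $$ (r, c)\<bar>) +
       (\<Sum>i\<in>{i. i < n \<and> 2 * m + i \<noteq> r}. \<bar>?d (1 / K) r * A $$ (r, 2 * m + i)\<bar> * K)"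
      using K by (simp add: B split r abs_mult)
    also have "\<dots> \<le> \<bar>A $$ (r, r)\<bar>"
    proof (cases "r < 2 * m")
      case True
      then have "{i. i < n \<and> 2 * m + i \<noteq> r} = {..<n}" by auto
      then show ?thesis using row1[OF True] True by (simp add: sum_distrib_left mult.commute)
    next
      case False
      then obtain i where i: "r = 2 * m + i" "i < n" using r by (metis add_less_cancel_left
          le_add_diff_inverse not_less)
      then have "{j. j < n \<and> 2 * m + j \<noteq> r} = {..<n} - {i}" "{..<2 * m} - {r} = {..<2 * m}" by auto
      then show ?thesis using row2[OF i(2)] K by (simp add: i abs_mult sum_divide_distrib)
    qed
    also have "\<bar>A $$ (r, r)\<bar> = \<bar>modified_hessian m n K A $$ (r, r)\<bar>"
      using K by (simp add: e[OF r])
    finally show "(\<Sum>c\<in>{..<dim_col (modified_hessian m n K A)} - {r}. \<bar>modified_hessian m n K A $$ (r, c)\<bar>)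
        \<le> \<bar>modified_hessian m n K A $$ (r, r)\<bar>" .
  qed
qed

lemma sum_div_two:
  fixes g :: "nat \<Rightarrow> real"
  shows "(\<Sum>c<2 * m. g (c div 2)) = 2 * (\<Sum>k<m. g k)"
  by (induction m) (simp_all add: algebra_simps)

section \<open>Entries of the Hessian\<close>

lemma curv_smult: "c \<noteq> 0 \<Longrightarrow> curv (Polynomial.smult c p) z = curv p z"
  by (simp add: curv_def pderiv_smult)

lemma all_points_coords:
  "k < m \<Longrightarrow> all_points m (coords m z x) k = z k"
  "all_points m (coords m z x) (m + i) = of_real (x i)"
  by (simp_all add: all_points_def cpoint_coords rpoint_coords)

text \<open>The second complex derivative of the energy with respect to the \<open>k\<close>-th complex point.\<close>
definition exc_diag :: "real poly \<Rightarrow> nat \<Rightarrow> nat \<Rightarrow> (nat \<Rightarrow> complex) \<Rightarrow> (nat \<Rightarrow> real) \<Rightarrow> nat \<Rightarrow> complex" where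
  "exc_diag H m n z x k = - 2 * (curv H (z k) + (\<Sum>l\<in>{..<m} - {k}. 1 / (z k - z l)\<^sup>2)
     + (\<Sum>i<n. 1 / (z k - of_real (x i))\<^sup>2))"

text \<open>The same for the \<open>i\<close>-th real point.\<close>
definition reg_diag :: "real poly \<Rightarrow> nat \<Rightarrow> nat \<Rightarrow> (nat \<Rightarrow> complex) \<Rightarrow> (nat \<Rightarrow> real) \<Rightarrow> nat \<Rightarrow> complex" where
  "reg_diag H m n z x i = - 2 * (curv H (of_real (x i)) + (\<Sum>k<m. 1 / (of_real (x i) - z k)\<^sup>2)
     + (\<Sum>j\<in>{..<n} - {i}. 1 / of_real ((x i - x j)\<^sup>2)))"

lemma sum_split_remove:
  fixes f :: "nat \<Rightarrow> 'a :: comm_monoid_add"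
  shows "k < m \<Longrightarrow> (\<Sum>l\<in>{..<m + n} - {k}. f l) = (\<Sum>l\<in>{..<m} - {k}. f l) + (\<Sum>i<n. f (m + i))"
    and "i < n \<Longrightarrow> (\<Sum>l\<in>{..<m + n} - {m + i}. f l) = (\<Sum>l<m. f l) + (\<Sum>j\<in>{..<n} - {i}. f (m + j))"
proof -
  have *: "(\<Sum>l\<in>{..<m + n} - {p}. f l) = (\<Sum>l<m + n. if l = p then 0 else f l)" for p m n :: nat
    by (intro sum.mono_neutral_cong_left) auto
  have **: "(\<Sum>l\<in>{..<m} - {p}. f l) = (\<Sum>l<m. if l = p then 0 else f l)" for p m :: nat and f :: "nat \<Rightarrow> 'a"
    by (intro sum.mono_neutral_cong_left) auto
  show "(\<Sum>l\<in>{..<m + n} - {k}. f l) = (\<Sum>l\<in>{..<m} - {k}. f l) + (\<Sum>i<n. f (m + i))" if "k < m"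
    unfolding ** sum_split_add using that by (auto intro!: sum.cong)
  show "(\<Sum>l\<in>{..<m + n} - {m + i}. f l) = (\<Sum>l<m. f l) + (\<Sum>j\<in>{..<n} - {i}. f (m + j))" if "i < n"
    unfolding ** sum_split_add using that by (intro arg_cong2[where f = "(+)"] sum.cong) auto
qed

context
  fixes H :: "real poly" and m n :: nat and z :: "nat \<Rightarrow> complex" and x :: "nat \<Rightarrow> real" and A :: "real mat"
  assumes adm: "admissible H m n (coords m z x)"
  defines "A \<equiv> hessian (2 * m + n) (log_energy H m n) (coords m z x)"
begin

lemma hess_diag_exc: "k < m \<Longrightarrow> energy_hess H (m + n) (all_points m (coords m z x)) k k = exc_diag H m
    n z x k"
  unfolding energy_hess_def exc_diag_def curv_def
  by (simp add: sum_split_remove(1) all_points_coords)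
    (simp add: sum_distrib_left sum_negf algebra_simps)

lemma hess_diag_reg:
  "i < n \<Longrightarrow> energy_hess H (m + n) (all_points m (coords m z x)) (m + i) (m + i) = reg_diag H m n z x i"
  unfolding energy_hess_def reg_diag_def curv_def
  by (simp add: sum_split_remove(2) all_points_coords)
    (simp add: sum_distrib_left sum_negf algebra_simps)

lemma A_entry:
  "i < 2 * m + n \<Longrightarrow> j < 2 * m + n \<Longrightarrow> A $$ (i, j) =
     Re (coord_dir m i * coord_dir m j * energy_hess H (m + n) (all_points m (coords m z x))
         (coord_point m j) (coord_point m i))"
  unfolding A_def by (rule hessian_log_energy[OF adm])

lemma A_entry_le:
  assumes "i < 2 * m + n" "j < 2 * m + n" "coord_point m i \<noteq> coord_point m j"
  shows "\<bar>A $$ (i, j)\<bar> \<le> 2 / (cmod (all_points m (coords m z x) (coord_point m i) - all_points m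
      (coords m z x) (coord_point m j)))\<^sup>2"
proof -
  have "\<bar>A $$ (i, j)\<bar> \<le> cmod (coord_dir m i * coord_dir m j * energy_hess H (m + n) (all_points m
      (coords m z x)) (coord_point m j) (coord_point m i))"
    unfolding A_entry[OF assms(1,2)] by (rule abs_Re_le_cmod)
  also have "\<dots> = 2 / (cmod (all_points m (coords m z x) (coord_point m j) - all_points m (coords m z
      x) (coord_point m i)))\<^sup>2"
    using assms(3) by (simp add: energy_hess_def coord_dir_def norm_mult norm_divide norm_power)
  finally show ?thesis by (simp add: norm_minus_commute)
qed

lemma A_exc_even: "k < m \<Longrightarrow> A $$ (2 * k, 2 * k) = Re (exc_diag H m n z x k)"
  by (simp add: A_entry coord_point_def coord_dir_def hess_diag_exc)

lemma A_exc_odd: "k < m \<Longrightarrow> A $$ (2 * k + 1, 2 * k + 1) = - Re (exc_diag H m n z x k)"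
  by (simp add: A_entry coord_point_def coord_dir_def hess_diag_exc)

lemma A_reg: "i < n \<Longrightarrow> A $$ (2 * m + i, 2 * m + i) = Re (reg_diag H m n z x i)"
  by (simp add: A_entry coord_point_def coord_dir_def hess_diag_reg)

lemma A_exc_diag: "r < 2 * m \<Longrightarrow> \<bar>A $$ (r, r)\<bar> = \<bar>Re (exc_diag H m n z x (r div 2))\<bar>"
  using A_exc_even[of "r div 2"] A_exc_odd[of "r div 2"] by (cases "even r") auto

lemma A_exc_partner:
  assumes "r < 2 * m" "c < 2 * m" "c \<noteq> r" "c div 2 = r div 2"
  shows "\<bar>A $$ (r, c)\<bar> = \<bar>Im (exc_diag H m n z x (r div 2))\<bar>"
proof -
  have "even r \<noteq> even c" using assms(3,4) by (metis dvd_mult_div_cancel odd_two_times_div_two_succ)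
  then have "coord_dir m r * coord_dir m c = \<i>" using assms by (auto simp: coord_dir_def)
  moreover have "r div 2 < m" using assms by auto
  ultimately show ?thesis
    using assms A_entry[of r c] by (simp add: coord_point_def hess_diag_exc)
qed

text \<open>The deterministic part of the argument. \<open>S\<close> bounds the interaction among the complex points,
  \<open>\<eta> N\<close> bounds both the deviation of \<open>\<kappa>\<close> from \<open>2 N\<close> and the interaction with the real points.\<close>
lemma dominance:
  fixes N \<eta> S K :: real
  assumes K: "K > 0" and N: "N > 0" and \<eta>: "\<eta> \<ge> 0" and small: "8 * S + (8 + 2 * K) * (\<eta> * N) < 4 * N"
    and curv: "\<And>k. k < m \<Longrightarrow> cmod (curv H (z k) - of_real (2 * N)) \<le> \<eta> * N"
    and exc: "\<And>k. k < m \<Longrightarrow> (\<Sum>l\<in>{..<m} - {k}. 1 / (cmod (z k - z l))\<^sup>2) \<le> S"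
    and reg: "\<And>k. k < m \<Longrightarrow> (\<Sum>i<n. 1 / (cmod (z k - of_real (x i)))\<^sup>2) \<le> \<eta> * N"
    and pos: "\<And>i. i < n \<Longrightarrow> 0 < Re (curv H (of_real (x i)) + (\<Sum>k<m. 1 / (of_real (x i) - z k)\<^sup>2))"
    and dom: "\<And>i. i < n \<Longrightarrow> 2 / K * (\<Sum>k<m. 1 / (cmod (of_real (x i) - z k))\<^sup>2)
        \<le> Re (curv H (of_real (x i)) + (\<Sum>k<m. 1 / (of_real (x i) - z k)\<^sup>2))"
  shows "diagonally_dominant (modified_hessian m n K A) \<and>
    (\<forall>i<n. A $$ (2 * m + i, 2 * m + i) < 0) \<and>
    (\<forall>l<m. A $$ (2 * l, 2 * l) = - (A $$ (2 * l + 1, 2 * l + 1)) \<and> A $$ (2 * l, 2 * l) < 0)"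
proof -
  have exc_diag: "cmod (exc_diag H m n z x k + of_real (4 * N)) \<le> 4 * \<eta> * N + 2 * S" if k: "k < m" for k
  proof -
    let ?a = "curv H (z k) - of_real (2 * N)" and ?b = "\<Sum>l\<in>{..<m} - {k}. 1 / (z k - z l)\<^sup>2"
      and ?c = "\<Sum>i<n. 1 / (z k - of_real (x i))\<^sup>2"
    have b: "cmod ?b \<le> S"
      using sum_norm_le[of "{..<m} - {k}" "\<lambda>l. 1 / (z k - z l)\<^sup>2" "\<lambda>l. 1 / (cmod (z k - z l))\<^sup>2"] exc[OF k]
      by (simp add: norm_divide norm_power)
    have c: "cmod ?c \<le> \<eta> * N"
      using sum_norm_le[of "{..<n}" "\<lambda>i. 1 / (z k - of_real (x i))\<^sup>2" "\<lambda>i. 1 / (cmod (z k - of_real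
          (x i)))\<^sup>2"] reg[OF k]
      by (simp add: norm_divide norm_power)
    have "cmod (?a + ?b + ?c) \<le> \<eta> * N + S + \<eta> * N"
      using curv[OF k] b c norm_triangle_ineq[of "?a + ?b" ?c] norm_triangle_ineq[of ?a ?b] by linarith
    moreover have "exc_diag H m n z x k + of_real (4 * N) = - 2 * (?a + ?b + ?c)"
      by (simp add: exc_diag_def algebra_simps)
    ultimately show ?thesis by (simp only: norm_mult) (simp add: algebra_simps)
  qed
  have re: "Re (exc_diag H m n z x k) \<le> - 4 * N + 4 * \<eta> * N + 2 * S"
    and im: "\<bar>Im (exc_diag H m n z x k)\<bar> \<le> 4 * \<eta> * N + 2 * S" if "k < m" for k
    using exc_diag[OF that] abs_Re_le_cmod[of "exc_diag H m n z x k + of_real (4 * N)"]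
      abs_Im_le_cmod[of "exc_diag H m n z x k + of_real (4 * N)"] by auto
  have S0: "S \<ge> 0" if "m > 0"
    using exc[OF that] by (rule order.trans[rotated]) (auto intro: sum_nonneg)
  have \<eta>N: "\<eta> * N \<ge> 0" using \<eta> N by simp
  have K\<eta>N: "K * (\<eta> * N) \<ge> 0" using K \<eta>N by simp
  have small': "8 * S + 8 * (\<eta> * N) + 2 * (K * (\<eta> * N)) < 4 * N"
    using small by (simp add: algebra_simps)
  have re_neg: "Re (exc_diag H m n z x k) < 0" if "k < m" for k
    using re[OF that] small' S0 \<eta>N K\<eta>N that by simp
  have neg: "A $$ (2 * m + i, 2 * m + i) < 0" if "i < n" for i
  proof -
    have "(\<Sum>j\<in>{..<n} - {i}. 1 / (x i - x j)\<^sup>2) \<ge> 0" by (intro sum_nonneg) auto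
    moreover have "Re (\<Sum>j\<in>{..<n} - {i}. 1 / complex_of_real ((x i - x j)\<^sup>2)) = (\<Sum>j\<in>{..<n} - {i}. 1 /
        (x i - x j)\<^sup>2)"
      by (simp add: Re_divide_of_real del: of_real_power of_real_diff)
    ultimately show ?thesis
      using pos[OF that] by (simp add: A_reg[OF that] reg_diag_def del: of_real_power of_real_diff Re_sum)
  qed
  have "diagonally_dominant (modified_hessian m n K A)"
  proof (rule diagonally_dominant_modified_hessian[OF _ K])
    show "A \<in> carrier_mat (2 * m + n) (2 * m + n)" by (simp add: A_def hessian_def)
  next
    fix r assume r: "r < 2 * m"
    define k where "k = r div 2"
    have k: "k < m" using r by (simp add: k_def)
    let ?g = "\<lambda>l. if l = k then 0 else 2 / (cmod (z k - z l))\<^sup>2"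
    \<comment> \<open>the other real variable of the same complex point\<close>
    define p where "p = (if even r then r + 1 else r - 1)"
    have g: "(\<Sum>c<2 * m. ?g (c div 2)) = 2 * (\<Sum>l<m. ?g l)" by (rule sum_div_two)
    have "(\<Sum>c\<in>{..<2 * m} - {r}. \<bar>A $$ (r, c)\<bar>) \<le>
        (\<Sum>c\<in>{..<2 * m} - {r}. (if c = p then \<bar>Im (exc_diag H m n z x k)\<bar> else 0) + ?g (c div 2))"
    proof (rule sum_mono)
      fix c assume "c \<in> {..<2 * m} - {r}"
      then have c: "c < 2 * m" "c \<noteq> r" by auto
      show "\<bar>A $$ (r, c)\<bar> \<le> (if c = p then \<bar>Im (exc_diag H m n z x k)\<bar> else 0) + ?g (c div 2)"
      proof (cases "c div 2 = k")
        case True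
        then have "c = p" using c(2) unfolding k_def p_def by presburger
        then show ?thesis using A_exc_partner[OF r c(1,2)] True by (simp add: k_def)
      next
        case False
        have "\<bar>A $$ (r, c)\<bar> \<le> 2 / (cmod (z k - z (c div 2)))\<^sup>2"
          using A_entry_le[of r c] r c False k by (simp add: coord_point_def all_points_coords k_def)
        also have "\<dots> = ?g (c div 2)" using False by simp
        finally show ?thesis by (rule add_increasing[rotated]) (simp only: abs_ge_zero order.refl
            split: if_split, blast)
      qed
    qed
    also have "\<dots> \<le> (\<Sum>c<2 * m. (if c = p then \<bar>Im (exc_diag H m n z x k)\<bar> else 0) + ?g (c div 2))"
      by (intro sum_mono2) auto
    also have "\<dots> \<le> \<bar>Im (exc_diag H m n z x k)\<bar> + 2 * (\<Sum>l<m. ?g l)"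
      unfolding sum.distrib g by simp
    also have "(\<Sum>l<m. ?g l) = 2 * (\<Sum>l\<in>{..<m} - {k}. 1 / (cmod (z k - z l))\<^sup>2)"
      unfolding sum_distrib_left by (intro sum.mono_neutral_cong_right) auto
    finally have 1: "(\<Sum>c\<in>{..<2 * m} - {r}. \<bar>A $$ (r, c)\<bar>) \<le> 4 * (\<eta> * N) + 6 * S"
      using im[OF k] exc[OF k] by simp
    have "(\<Sum>i<n. \<bar>A $$ (r, 2 * m + i)\<bar>) \<le> (\<Sum>i<n. 2 * (1 / (cmod (z k - of_real (x i)))\<^sup>2))"
    proof (rule sum_mono)
      fix i assume "i \<in> {..<n}"
      then show "\<bar>A $$ (r, 2 * m + i)\<bar> \<le> 2 * (1 / (cmod (z k - of_real (x i)))\<^sup>2)"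
        using A_entry_le[of r "2 * m + i"] r k by (simp add: coord_point_def all_points_coords k_def)
    qed
    also have "\<dots> \<le> 2 * (\<eta> * N)" using reg[OF k] by (simp add: sum_distrib_left[symmetric] del:
        mult_divide_mult_cancel_left_if times_divide_eq_right)
    finally have "K * (\<Sum>i<n. \<bar>A $$ (r, 2 * m + i)\<bar>) \<le> K * (2 * (\<eta> * N))"
      using K by (intro mult_left_mono) auto
    with 1 have "(\<Sum>c\<in>{..<2 * m} - {r}. \<bar>A $$ (r, c)\<bar>) + K * (\<Sum>i<n. \<bar>A $$ (r, 2 * m + i)\<bar>)
        \<le> 4 * (\<eta> * N) + 6 * S + 2 * (K * (\<eta> * N))" by simp
    also have "\<dots> \<le> \<bar>A $$ (r, r)\<bar>"
      using re[OF k] re_neg[OF k] small' A_exc_diag[OF r] by (simp add: k_def)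
    finally show "(\<Sum>c\<in>{..<2 * m} - {r}. \<bar>A $$ (r, c)\<bar>) + K * (\<Sum>i<n. \<bar>A $$ (r, 2 * m + i)\<bar>) \<le> \<bar>A $$
        (r, r)\<bar>" .
  next
    fix i assume i: "i < n"
    let ?g = "\<lambda>k. 2 / (cmod (of_real (x i) - z k))\<^sup>2"
    let ?Y = "\<Sum>j\<in>{..<n} - {i}. 1 / (x i - x j)\<^sup>2"
    have "(\<Sum>c<2 * m. \<bar>A $$ (2 * m + i, c)\<bar>) \<le> (\<Sum>c<2 * m. ?g (c div 2))"
    proof (rule sum_mono)
      fix c assume "c \<in> {..<2 * m}"
      then show "\<bar>A $$ (2 * m + i, c)\<bar> \<le> ?g (c div 2)"
        using A_entry_le[of "2 * m + i" c] i by (auto simp: coord_point_def all_points_coords)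
    qed
    also have "\<dots> = 4 * (\<Sum>k<m. 1 / (cmod (of_real (x i) - z k))\<^sup>2)"
      using sum_div_two[of ?g m] by (simp add: sum_distrib_left)
    finally have 1: "(\<Sum>c<2 * m. \<bar>A $$ (2 * m + i, c)\<bar>) / K \<le> 2 * (2 / K * (\<Sum>k<m. 1 / (cmod (of_real
        (x i) - z k))\<^sup>2))"
      using K by (simp add: divide_simps)
    have "(\<Sum>j\<in>{..<n} - {i}. \<bar>A $$ (2 * m + i, 2 * m + j)\<bar>) \<le> (\<Sum>j\<in>{..<n} - {i}. 2 * (1 / (x i - x j)\<^sup>2))"
    proof (rule sum_mono)
      fix j assume j: "j \<in> {..<n} - {i}"
      have "cmod (complex_of_real (x i) - complex_of_real (x j)) = \<bar>x i - x j\<bar>"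
        by (metis norm_of_real of_real_diff)
      then show "\<bar>A $$ (2 * m + i, 2 * m + j)\<bar> \<le> 2 * (1 / (x i - x j)\<^sup>2)"
        using A_entry_le[of "2 * m + i" "2 * m + j"] i j by (simp add: coord_point_def all_points_coords)
    qed
    also have "\<dots> = 2 * ?Y" by (simp add: sum_distrib_left)
    finally have 2: "(\<Sum>j\<in>{..<n} - {i}. \<bar>A $$ (2 * m + i, 2 * m + j)\<bar>) \<le> 2 * ?Y" .
    have "Re (\<Sum>j\<in>{..<n} - {i}. 1 / complex_of_real ((x i - x j)\<^sup>2)) = ?Y"
      by (simp add: Re_divide_of_real del: of_real_power of_real_diff)
    then have "- A $$ (2 * m + i, 2 * m + i) =
        2 * Re (curv H (of_real (x i)) + (\<Sum>k<m. 1 / (of_real (x i) - z k)\<^sup>2)) + 2 * ?Y"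
      by (simp add: A_reg[OF i] reg_diag_def del: of_real_power of_real_diff Re_sum)
    with 1 2 dom[OF i] neg[OF i]
    show "(\<Sum>c<2 * m. \<bar>A $$ (2 * m + i, c)\<bar>) / K + (\<Sum>j\<in>{..<n} - {i}. \<bar>A $$ (2 * m + i, 2 * m + j)\<bar>)
        \<le> \<bar>A $$ (2 * m + i, 2 * m + i)\<bar>" by linarith
  qed
  then show ?thesis using neg re_neg A_exc_even A_exc_odd by simp
qed

end

section \<open>The saddle point\<close>

lemma finite_positive_lower_bound:
  fixes f :: "'a \<Rightarrow> real"
  assumes "finite S" "\<And>s. s \<in> S \<Longrightarrow> f s > 0"
  obtains d where "d > 0" "\<And>s. s \<in> S \<Longrightarrow> d \<le> f s"
proof -
  have "Min (insert 1 (f ` S)) > 0" using assms by (subst Min_gr_iff) auto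
  moreover have "Min (insert 1 (f ` S)) \<le> f s" if "s \<in> S" for s using assms that by (intro Min_le) auto
  ultimately show ?thesis using that by blast
qed

lemma curv_near_root:
  assumes \<zeta>: "Im \<zeta> \<noteq> 0" and \<epsilon>: "\<epsilon> > 0"
  shows "\<exists>\<delta>>0. \<forall>\<^sub>F N in sequentially. \<forall>u. cmod (u - \<zeta>) < \<delta> \<longrightarrow> cpoly (exc \<nu> N) u = 0 \<longrightarrow>
     cpoly (hermite_wr \<nu>) u \<noteq> 0 \<and> cmod (curv (hermite_wr \<nu>) u - 2 * of_nat N) \<le> \<epsilon> * real N"
proof -
  from curv_at_exc_roots_limit[OF \<zeta> \<epsilon>, of \<nu>] obtain P Q where
    P: "eventually P sequentially" and Q: "eventually Q (nhds \<zeta>)"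
    and PQ: "\<And>N u. P N \<Longrightarrow> Q u \<Longrightarrow> cpoly (exc \<nu> N) u = 0 \<longrightarrow>
     cpoly (hermite_wr \<nu>) u \<noteq> 0 \<and> cmod (curv (hermite_wr \<nu>) u - 2 * of_nat N) \<le> \<epsilon> * real N"
    unfolding eventually_prod_filter by auto
  from Q obtain \<delta> where "\<delta> > 0" "\<And>u. dist u \<zeta> < \<delta> \<Longrightarrow> Q u" unfolding eventually_nhds_metric by blast
  then show ?thesis
    using P PQ by (intro exI[of _ \<delta>] conjI) (auto elim!: eventually_mono simp: dist_norm)
qed

lemma inverse_square_close:
  fixes a b :: complex
  assumes "cmod a \<ge> \<rho>" "cmod b \<ge> \<rho>" "\<rho> > 0" "cmod (a - b) \<le> \<epsilon>"
  shows "cmod (1 / a\<^sup>2 - 1 / b\<^sup>2) \<le> 2 * \<epsilon> / \<rho> ^ 3"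
proof -
  have a: "a \<noteq> 0" and b: "b \<noteq> 0" using assms by auto
  have \<epsilon>: "\<epsilon> \<ge> 0" using assms(4) by (rule order.trans[OF norm_ge_zero])
  have "1 / a\<^sup>2 - 1 / b\<^sup>2 = (b - a) * (1 / a) * (1 / b) * (1 / a + 1 / b)"
    using a b by (simp add: field_simps power2_eq_square)
  then have "cmod (1 / a\<^sup>2 - 1 / b\<^sup>2) = cmod (b - a) * (1 / cmod a) * (1 / cmod b) * cmod (1 / a + 1 / b)"
    by (simp add: norm_mult norm_divide)
  also have "\<dots> \<le> \<epsilon> * (1 / \<rho>) * (1 / \<rho>) * (1 / \<rho> + 1 / \<rho>)"
  proof (intro mult_mono)
    show "cmod (b - a) \<le> \<epsilon>" using assms by (simp add: norm_minus_commute)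
    show "1 / cmod a \<le> 1 / \<rho>" "1 / cmod b \<le> 1 / \<rho>" using assms a b by (auto intro!: divide_left_mono
        mult_pos_pos)
    then show "cmod (1 / a + 1 / b) \<le> 1 / \<rho> + 1 / \<rho>"
      using norm_triangle_ineq[of "1 / a" "1 / b"] by (simp add: norm_divide)
  qed (use assms \<epsilon> in auto)
  also have "\<dots> = 2 * \<epsilon> / \<rho> ^ 3"
    using assms by (simp add: field_simps power3_eq_cube)
  finally show ?thesis .
qed

text \<open>For \<open>w\<close> above all zeros \<open>u\<close> the numbers \<open>- Im (1/(w - u))\<close> are nonnegative and those of the real
  zeros are at least \<open>1/\<bar>w - u\<bar>\<^sup>2\<close>, as \<open>Im w \<ge> 1\<close>.\<close>
lemma sum_real_roots_bound:
  assumes P: "P \<noteq> 0" "degree P \<le> card {u. cpoly P u = 0}"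
    and w: "cpoly P w \<noteq> 0" "Im w \<ge> 1"
    and below: "\<And>u. cpoly P u = 0 \<Longrightarrow> Im u \<le> Im w"
    and R: "R \<subseteq> {t. poly P t = 0}"
  shows "(\<Sum>t\<in>R. 1 / (cmod (w - of_real t))\<^sup>2) \<le> cmod (cpoly (pderiv P) w / cpoly P w)"
proof -
  let ?S = "{u. cpoly P u = 0}"
  have im: "- Im (1 / (w - u)) = (Im w - Im u) / (cmod (w - u))\<^sup>2" for u
    by (simp add: Im_divide cmod_power2 diff_divide_distrib)
  have "(\<Sum>t\<in>R. 1 / (cmod (w - of_real t))\<^sup>2) \<le> (\<Sum>t\<in>R. - Im (1 / (w - of_real t)))"
    unfolding im using w(2) by (intro sum_mono divide_right_mono) auto
  also have "\<dots> = (\<Sum>u\<in>of_real ` R. - Im (1 / (w - u)))"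
    by (subst sum.reindex) (auto simp: inj_on_def)
  also have "\<dots> \<le> (\<Sum>u\<in>?S. - Im (1 / (w - u)))"
    unfolding im using R below finite_cpoly_roots[OF P(1)] by (intro sum_mono2) (auto simp: cpoly_of_real)
  also have "\<dots> = - Im (cpoly (pderiv P) w / cpoly P w)"
    unfolding cpoly_log_deriv[OF P w(1)] by (simp add: sum_negf)
  also have "\<dots> \<le> cmod (cpoly (pderiv P) w / cpoly P w)"
    using abs_Im_le_cmod[of "cpoly (pderiv P) w / cpoly P w"] by linarith
  finally show ?thesis .
qed

lemma inverse_square_compare:
  fixes v w t :: complex
  assumes "cmod (v - t) \<ge> \<rho>" "\<rho> > 0" "cmod (w - v) \<le> Q" "w \<noteq> t"
  shows "1 / (cmod (v - t))\<^sup>2 \<le> (1 + Q / \<rho>)\<^sup>2 * (1 / (cmod (w - t))\<^sup>2)"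
proof -
  have Q: "Q \<ge> 0" using assms(3) by (rule order.trans[OF norm_ge_zero])
  have "cmod (w - t) \<le> cmod (w - v) + cmod (v - t)" using norm_triangle_ineq[of "w - v" "v - t"] by simp
  also have "cmod (w - v) \<le> Q / \<rho> * cmod (v - t)"
    using mult_left_mono[OF assms(1), of "Q / \<rho>"] assms(2,3) Q by simp
  finally have "cmod (w - t) \<le> (1 + Q / \<rho>) * cmod (v - t)" by (simp add: algebra_simps)
  then have "(cmod (w - t))\<^sup>2 \<le> (1 + Q / \<rho>)\<^sup>2 * (cmod (v - t))\<^sup>2"
    using power_mono[of "cmod (w - t)" "(1 + Q / \<rho>) * cmod (v - t)" 2] by (simp add: power_mult_distrib)
  moreover have "cmod (v - t) > 0" "cmod (w - t) > 0" using assms by auto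
  ultimately show ?thesis by (simp add: divide_simps mult.commute)
qed

text \<open>The claim for any nonzero multiple of the Wronskian of two Hermite polynomials.\<close>
lemma exc_dominance:
  fixes \<nu> :: nat and c :: real
  assumes \<nu>: "\<nu> \<ge> 1" and c: "c \<noteq> 0"
  defines "m \<equiv> 2 * \<nu>"
  shows "\<exists>K>0. \<forall>\<^sub>F n in sequentially. \<forall>z x.
     bij_betw z {..<m} {u. cpoly (exc \<nu> (n + 2)) u = 0 \<and> Im u \<noteq> 0} \<longrightarrow>
     bij_betw x {..<n} {t. poly (exc \<nu> (n + 2)) t = 0} \<longrightarrow>
     (let A = hessian (2 * m + n) (log_energy (Polynomial.smult c (hermite_wr \<nu>)) m n) (coords m z x)
      in diagonally_dominant (modified_hessian m n K A) \<and>
        (\<forall>i<n. A $$ (2 * m + i, 2 * m + i) < 0) \<and>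
        (\<forall>l<m. A $$ (2 * l, 2 * l) = - (A $$ (2 * l + 1, 2 * l + 1)) \<and> A $$ (2 * l, 2 * l) < 0))"
proof -
  define Z where "Z = {\<zeta>. cpoly (hermite_wr \<nu>) \<zeta> = 0}"
  have Z: "finite Z" "card Z = m"
    using finite_cpoly_roots[OF hermite_wr_nonzero] card_roots_hermite_wr by (auto simp: Z_def m_def)
  have m: "m > 0" using \<nu> by (simp add: m_def)
  obtain \<rho>' where \<rho>': "\<rho>' > 0" "\<And>\<zeta>. \<zeta> \<in> Z \<Longrightarrow> \<rho>' \<le> \<bar>Im \<zeta>\<bar>"
    using finite_positive_lower_bound[OF Z(1), of "\<lambda>\<zeta>. \<bar>Im \<zeta>\<bar>"] Im_root_hermite_wr by (auto simp: Z_def)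
  define \<rho> where "\<rho> = \<rho>' / 2"
  have \<rho>: "\<rho> > 0" "\<And>\<zeta>. \<zeta> \<in> Z \<Longrightarrow> 2 * \<rho> \<le> \<bar>Im \<zeta>\<bar>" using \<rho>' by (simp_all add: \<rho>_def)
  obtain d where d: "d > 0" "\<And>\<zeta> \<zeta>'. \<zeta> \<in> Z \<Longrightarrow> \<zeta>' \<in> Z \<Longrightarrow> \<zeta> \<noteq> \<zeta>' \<Longrightarrow> d \<le> cmod (\<zeta> - \<zeta>')"
  proof -
    have "finite {p \<in> Z \<times> Z. fst p \<noteq> snd p}" using Z by auto
    then obtain e where e: "e > 0" "\<And>p. p \<in> {p \<in> Z \<times> Z. fst p \<noteq> snd p} \<Longrightarrow> e \<le> cmod (fst p - snd p)"
      by (rule finite_positive_lower_bound[of _ "\<lambda>p. cmod (fst p - snd p)"]) auto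
    show ?thesis
    proof (rule that[OF e(1)])
      show "e \<le> cmod (\<zeta> - \<zeta>')" if "\<zeta> \<in> Z" "\<zeta>' \<in> Z" "\<zeta> \<noteq> \<zeta>'" for \<zeta> \<zeta>'
        using e(2)[of "(\<zeta>, \<zeta>')"] that by simp
    qed
  qed
  obtain T where T: "T > 0" "\<And>\<zeta>. \<zeta> \<in> Z \<Longrightarrow> cmod \<zeta> \<le> T"
    using finite_imp_bounded[OF Z(1)] unfolding bounded_pos by blast
  \<comment> \<open>makes the scaled interaction of a real point with the complex ones at most \<open>1/2\<close>, see \<open>reg_dom\<close>\<close>
  define K where "K = 4 * real m / \<rho>\<^sup>2"
  have K: "K > 0" using m \<rho> by (simp add: K_def)
  define \<eta> where "\<eta> = 1 / (8 + 2 * K)"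
  have \<eta>: "\<eta> > 0" "(8 + 2 * K) * \<eta> = 1" using K by (simp_all add: \<eta>_def)
  \<comment> \<open>for large \<open>n\<close> above all zeros of \<open>P\<close>, which lie within distance 1 of those of \<open>W\<close> or on the real line\<close>
  define w where "w = Complex 0 (T + 1)"
  define Q where "Q = cmod w + T + 1"
  define L where "L = (1 + Q / \<rho>)\<^sup>2"
  have "Q \<ge> 0" using T(1) norm_ge_zero[of w] unfolding Q_def by linarith
  then have "1 + Q / \<rho> > 0" using \<rho>(1) by (intro add_pos_nonneg divide_nonneg_pos) auto
  then have L: "L > 0" unfolding L_def by (rule zero_less_power)
  have w: "Im w = T + 1" by (simp add: w_def)
  have wZ: "cpoly (hermite_wr \<nu>) w \<noteq> 0"
    using T(2)[of w] abs_Im_le_cmod[of w] w by (auto simp: Z_def)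
  define near_ok where "near_ok \<zeta> \<delta> \<longleftrightarrow> (\<forall>\<^sub>F N in sequentially. \<forall>u. cmod (u - \<zeta>) < \<delta> \<longrightarrow>
     cpoly (exc \<nu> N) u = 0 \<longrightarrow>
     cpoly (hermite_wr \<nu>) u \<noteq> 0 \<and> cmod (curv (hermite_wr \<nu>) u - 2 * of_nat N) \<le> \<eta> * real N)" for \<zeta> \<delta>
  have "\<forall>\<zeta>\<in>Z. \<exists>\<delta>. \<delta> > 0 \<and> near_ok \<zeta> \<delta>"
    unfolding near_ok_def
    by (intro ballI curv_near_root Im_root_hermite_wr \<eta>(1)) (simp add: Z_def)
  from bchoice[OF this] obtain \<Delta> where \<Delta>: "\<And>\<zeta>. \<zeta> \<in> Z \<Longrightarrow> \<Delta> \<zeta> > 0"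
    and curv_ev: "\<And>\<zeta>. \<zeta> \<in> Z \<Longrightarrow> near_ok \<zeta> (\<Delta> \<zeta>)"
    by blast
  obtain \<delta> where \<delta>: "\<delta> > 0" "\<And>\<zeta>. \<zeta> \<in> Z \<Longrightarrow> \<delta> \<le> \<Delta> \<zeta>"
    using finite_positive_lower_bound[OF Z(1), of \<Delta>] \<Delta> by blast
  \<comment> \<open>the bounds keep the zeros off the real axis, apart, below \<open>w\<close>, make the two sums in
    \<open>reg_curv\<close> differ by at most \<open>1/2\<close>, and make the estimate of \<open>\<kappa>\<close> valid\<close>
  define \<epsilon> where "\<epsilon> = Min {\<rho>, d / 3, 1, \<rho> ^ 3 / (4 * real m), \<delta>}"
  have \<epsilon>: "\<epsilon> > 0" "\<epsilon> \<le> \<rho>" "\<epsilon> \<le> d / 3" "\<epsilon> \<le> 1" "\<epsilon> \<le> \<rho> ^ 3 / (4 * real m)" "\<epsilon> \<le> \<delta>"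
    unfolding \<epsilon>_def using \<rho> d \<delta> m by (auto simp: Min_gr_iff intro!: Min_le)
  define S where "S = real m / (d / 3)\<^sup>2"
  have ev1: "\<forall>\<^sub>F N in sequentially. \<forall>\<zeta>\<in>Z. \<forall>u. cmod (u - \<zeta>) < \<epsilon> \<longrightarrow> cpoly (exc \<nu> N) u = 0 \<longrightarrow>
     cpoly (hermite_wr \<nu>) u \<noteq> 0 \<and> cmod (curv (hermite_wr \<nu>) u - 2 * of_nat N) \<le> \<eta> * real N"
  proof (intro eventually_ball_finite Z(1) ballI)
    fix \<zeta> assume \<zeta>: "\<zeta> \<in> Z"
    have "\<epsilon> \<le> \<Delta> \<zeta>" using \<epsilon>(6) \<delta>(2)[OF \<zeta>] by linarith
    with curv_ev[OF \<zeta>, unfolded near_ok_def] show "\<forall>\<^sub>F N in sequentially. \<forall>u. cmod (u - \<zeta>) < \<epsilon> \<longrightarrow>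
        cpoly (exc \<nu> N) u = 0 \<longrightarrow>
      cpoly (hermite_wr \<nu>) u \<noteq> 0 \<and> cmod (curv (hermite_wr \<nu>) u - 2 * of_nat N) \<le> \<eta> * real N"
      by (auto elim!: eventually_mono dest: order.strict_trans2)
  qed
  have ev2: "\<forall>\<^sub>F N in sequentially. \<forall>\<zeta>\<in>Z. \<exists>u. cpoly (exc \<nu> N) u = 0 \<and> cmod (u - \<zeta>) < \<epsilon>"
    using \<epsilon>(1) Z(1) by (intro eventually_ball_finite ballI exc_root_near) (auto simp: Z_def)
  have wim: "Im w \<noteq> 0" using w T by simp
  note ev3 = exc_log_deriv_limit(2)[OF wim wZ]
  have "\<eta> / L > 0" using \<eta> L by simp
  from tendstoD[OF exc_log_deriv_limit(1)[OF wim wZ] this]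
  have ev4: "\<forall>\<^sub>F N in sequentially. cmod (cpoly (pderiv (exc \<nu> N)) w / cpoly (exc \<nu> N) w / of_nat N)
      < \<eta> / L"
    by simp
  have ev5: "\<forall>\<^sub>F N in sequentially. real N > 4 * S \<and> N > 0"
    using filterlim_real_sequentially unfolding filterlim_at_top_dense
    by (intro eventually_conj eventually_gt_at_top) blast
  have shift: "filterlim (\<lambda>n::nat. n + 2) sequentially sequentially"
    by (rule filterlim_add_const_nat_at_top)
  have "\<forall>\<^sub>F n in sequentially. \<forall>z x.
     bij_betw z {..<m} {u. cpoly (exc \<nu> (n + 2)) u = 0 \<and> Im u \<noteq> 0} \<longrightarrow>
     bij_betw x {..<n} {t. poly (exc \<nu> (n + 2)) t = 0} \<longrightarrow>
     (let A = hessian (2 * m + n) (log_energy (Polynomial.smult c (hermite_wr \<nu>)) m n) (coords m z x)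
      in diagonally_dominant (modified_hessian m n K A) \<and>
        (\<forall>i<n. A $$ (2 * m + i, 2 * m + i) < 0) \<and>
        (\<forall>l<m. A $$ (2 * l, 2 * l) = - (A $$ (2 * l + 1, 2 * l + 1)) \<and> A $$ (2 * l, 2 * l) < 0))"
    using eventually_compose_filterlim[OF eventually_conj[OF ev1 eventually_conj[OF ev2
      eventually_conj[OF ev3 eventually_conj[OF ev4 ev5]]]] shift]
  proof eventually_elim
    case (elim n)
    define N where "N = n + 2"
    define P where "P = exc \<nu> N"
    have curv: "cpoly (hermite_wr \<nu>) u \<noteq> 0" "cmod (curv (hermite_wr \<nu>) u - 2 * of_nat N) \<le> \<eta> * real N"
      if "\<zeta> \<in> Z" "cmod (u - \<zeta>) < \<epsilon>" "cpoly P u = 0" for \<zeta> u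
      using elim that unfolding P_def N_def by blast+
    have near: "\<exists>u. cpoly P u = 0 \<and> cmod (u - \<zeta>) < \<epsilon>" if "\<zeta> \<in> Z" for \<zeta>
      using elim that unfolding P_def N_def by blast
    have Pw: "cpoly P w \<noteq> 0" and Pw': "cmod (cpoly (pderiv P) w / cpoly P w / of_nat N) < \<eta> / L"
      and "real N > 4 * S"
      using elim unfolding P_def N_def by blast+
    then have N: "real N > 4 * S" "N > 0" by (simp_all add: N_def)
    show ?case
    proof (intro allI impI)
      fix z :: "nat \<Rightarrow> complex" and x :: "nat \<Rightarrow> real"
      assume z: "bij_betw z {..<m} {u. cpoly (exc \<nu> (n + 2)) u = 0 \<and> Im u \<noteq> 0}"
        and x: "bij_betw x {..<n} {t. poly (exc \<nu> (n + 2)) t = 0}"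
      define X where "X = {u. cpoly P u = 0 \<and> Im u \<noteq> 0}"
      define R where "R = {t. poly P t = 0}"
      have zX: "bij_betw z {..<m} X" using z by (simp add: X_def P_def N_def)
      have xR: "bij_betw x {..<n} R" using x by (simp add: R_def P_def N_def)
      have X: "finite X" "card X = m" using bij_betw_finite[OF zX] bij_betw_same_card[OF zX] by auto
      have R: "finite R" "card R = n" using bij_betw_finite[OF xR] bij_betw_same_card[OF xR] by auto
      have P0: "P \<noteq> 0" using R(1) infinite_UNIV_char_0[where 'a = real] by (auto simp: R_def)
      have roots: "{u. cpoly P u = 0} = X \<union> complex_of_real ` R"
      proof (intro equalityI subsetI)
        fix u assume "u \<in> {u. cpoly P u = 0}"
        then have u: "cpoly P u = 0" by simp
        show "u \<in> X \<union> complex_of_real ` R"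
        proof (cases "Im u = 0")
          case True
          then have e: "u = of_real (Re u)" by (simp add: complex_eq_iff)
          have "poly P (Re u) = 0" using u cpoly_of_real[of P "Re u"] unfolding e[symmetric] by simp
          then show ?thesis using e unfolding R_def by blast
        qed (simp add: X_def u)
      qed (auto simp: X_def R_def cpoly_of_real)
      \<comment> \<open>so many distinct zeros force the zeros of \<open>P\<close> to be simple\<close>
      have "card {u. cpoly P u = 0} = m + n"
        unfolding roots using X R by (subst card_Un_disjoint) (auto simp: card_image inj_on_def X_def)
      then have degP: "degree P \<le> card {u. cpoly P u = 0}"
        using degree_exc_le[OF \<nu>, of n] by (simp add: P_def N_def m_def)
      obtain \<sigma> where \<sigma>: "bij_betw \<sigma> Z X" "\<And>\<zeta>. \<zeta> \<in> Z \<Longrightarrow> cmod (\<sigma> \<zeta> - \<zeta>) < \<epsilon>"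
      proof (rule close_separated_bij[of Z X \<epsilon>])
        show "finite Z" "finite X" "card Z = card X" using Z X by auto
        show "\<exists>u\<in>X. cmod (u - \<zeta>) < \<epsilon>" if \<zeta>: "\<zeta> \<in> Z" for \<zeta>
        proof -
          obtain u where u: "cpoly P u = 0" "cmod (u - \<zeta>) < \<epsilon>" using near[OF \<zeta>] by blast
          have "\<bar>Im u - Im \<zeta>\<bar> < \<rho>" using abs_Im_le_cmod[of "u - \<zeta>"] u(2) \<epsilon>(2) by simp
          then have "Im u \<noteq> 0" using \<rho>(1) \<rho>(2)[OF \<zeta>] by linarith
          then show ?thesis using u by (auto simp: X_def)
        qed
        show "2 * \<epsilon> \<le> cmod (\<zeta> - \<zeta>')" if "\<zeta> \<in> Z" "\<zeta>' \<in> Z" "\<zeta> \<noteq> \<zeta>'" for \<zeta> \<zeta>'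
          using d(2)[OF that] \<epsilon>(3) d(1) by linarith
      qed blast
      have z_near: "\<exists>\<zeta>\<in>Z. z k = \<sigma> \<zeta>" if "k < m" for k
      proof -
        have "z k \<in> \<sigma> ` Z" using bij_betwE[OF zX] that \<sigma>(1) by (simp add: bij_betw_def)
        then show ?thesis by blast
      qed
      have zP: "cpoly P (z k) = 0" "Im (z k) \<noteq> 0" if "k < m" for k
        using bij_betwE[OF zX] that by (auto simp: X_def)
      have Im_\<sigma>: "\<rho> \<le> \<bar>Im (\<sigma> \<zeta>)\<bar>" if \<zeta>: "\<zeta> \<in> Z" for \<zeta>
      proof -
        have "\<bar>Im (\<sigma> \<zeta>) - Im \<zeta>\<bar> < \<rho>" using abs_Im_le_cmod[of "\<sigma> \<zeta> - \<zeta>"] \<sigma>(2)[OF \<zeta>] \<epsilon>(2) by simp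
        then show ?thesis using \<rho>(2)[OF \<zeta>] by linarith
      qed
      have off_real: "\<rho> \<le> cmod (of_real t - u)" if "\<rho> \<le> \<bar>Im u\<bar>" for t u
        using abs_Im_le_cmod[of "of_real t - u"] that by simp
      have sum_z: "(\<Sum>k<m. f (z k)) = (\<Sum>\<zeta>\<in>Z. f (\<sigma> \<zeta>))" for f :: "complex \<Rightarrow> 'b::comm_monoid_add"
        using sum.reindex_bij_betw[OF zX, of f] sum.reindex_bij_betw[OF \<sigma>(1), of f] by simp
      let ?H = "Polynomial.smult c (hermite_wr \<nu>)"
      have adm: "admissible ?H m n (coords m z x)"
        unfolding admissible_def
      proof (intro conjI allI impI)
        have inj: "inj_on z {..<m}" "inj_on x {..<n}" using zX xR by (auto simp: bij_betw_def)
        have pts: "(k < m \<and> all_points m (coords m z x) k = z k) \<or>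
            (\<exists>i<n. k = m + i \<and> all_points m (coords m z x) k = of_real (x i))" if "k < m + n" for k
        proof (cases "k < m")
          case False
          then show ?thesis using that all_points_coords(2)[of m z x "k - m"]
            by (intro disjI2 exI[of _ "k - m"]) auto
        qed (simp add: all_points_coords)
        show "inj_on (all_points m (coords m z x)) {..<m + n}"
        proof (rule inj_onI)
          fix k l assume "k \<in> {..<m + n}" "l \<in> {..<m + n}"
            and eq: "all_points m (coords m z x) k = all_points m (coords m z x) l"
          then show "k = l"
            using pts[of k] pts[of l] inj zP(2) by (auto simp: inj_on_def complex_eq_iff)
        qed
        show "cpoly ?H (all_points m (coords m z x) k) \<noteq> 0" if k: "k < m + n" for k
          using pts[OF k]
        proof (elim disjE conjE exE)
          assume k: "k < m" "all_points m (coords m z x) k = z k"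
          obtain \<zeta> where \<zeta>: "\<zeta> \<in> Z" "z k = \<sigma> \<zeta>" using z_near[OF k(1)] by blast
          then show ?thesis using curv(1)[OF \<zeta>(1), of "z k"] \<sigma>(2)[OF \<zeta>(1)] zP(1)[OF k(1)] k c by simp
        next
          fix i assume "all_points m (coords m z x) k = of_real (x i)"
          then show ?thesis using c hermite_wr_pos[of \<nu> "x i"] by (simp add: cpoly_of_real)
        qed
      qed
      have dist_z: "d / 3 \<le> cmod (z k - z l)" if kl: "k < m" "l < m" "k \<noteq> l" for k l
      proof -
        obtain \<zeta> \<zeta>' where \<zeta>: "\<zeta> \<in> Z" "z k = \<sigma> \<zeta>" "\<zeta>' \<in> Z" "z l = \<sigma> \<zeta>'"
          using z_near[OF kl(1)] z_near[OF kl(2)] by blast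
        have "z k \<noteq> z l" using zX kl by (auto simp: bij_betw_def inj_on_def)
        then have "d \<le> cmod (\<zeta> - \<zeta>')" using \<zeta> by (intro d(2)) auto
        moreover have "cmod (\<zeta> - \<zeta>') \<le> cmod (\<sigma> \<zeta> - \<zeta>) + cmod (\<sigma> \<zeta>' - \<zeta>') + cmod (\<sigma> \<zeta> - \<sigma> \<zeta>')"
          using norm_triangle_ineq4[of "\<sigma> \<zeta> - \<sigma> \<zeta>' + (\<sigma> \<zeta>' - \<zeta>')" "\<sigma> \<zeta> - \<zeta>"]
            norm_triangle_ineq[of "\<sigma> \<zeta> - \<sigma> \<zeta>'" "\<sigma> \<zeta>' - \<zeta>'"] by simp
        ultimately show ?thesis using \<sigma>(2)[OF \<zeta>(1)] \<sigma>(2)[OF \<zeta>(3)] \<epsilon>(3) \<zeta> by simp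
      qed
      have curv_z: "cmod (curv ?H (z k) - of_real (2 * real N)) \<le> \<eta> * real N" if k: "k < m" for k
      proof -
        obtain \<zeta> where \<zeta>: "\<zeta> \<in> Z" "z k = \<sigma> \<zeta>" using z_near[OF k] by blast
        then show ?thesis
          using curv(2)[OF \<zeta>(1), of "z k"] \<sigma>(2)[OF \<zeta>(1)] zP(1)[OF k] by (simp add: curv_smult[OF c])
      qed
      have exc_sum: "(\<Sum>l\<in>{..<m} - {k}. 1 / (cmod (z k - z l))\<^sup>2) \<le> S" if k: "k < m" for k
      proof -
        have "(\<Sum>l\<in>{..<m} - {k}. 1 / (cmod (z k - z l))\<^sup>2) \<le> (\<Sum>l\<in>{..<m} - {k}. 1 / (d / 3)\<^sup>2)"
        proof (rule sum_mono)
          fix l assume "l \<in> {..<m} - {k}"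
          then have "(d / 3)\<^sup>2 \<le> (cmod (z k - z l))\<^sup>2" using dist_z[OF k, of l] d(1) by (intro
              power_mono) auto
          then show "1 / (cmod (z k - z l))\<^sup>2 \<le> 1 / (d / 3)\<^sup>2"
            using d(1) by (intro divide_left_mono mult_pos_pos) (auto intro: order.strict_trans2)
        qed
        also have "\<dots> = real (m - 1) * (1 / (d / 3)\<^sup>2)" using k by simp
        also have "\<dots> \<le> real m * (1 / (d / 3)\<^sup>2)" by (intro mult_right_mono) auto
        also have "\<dots> = S" by (simp add: S_def)
        finally show ?thesis .
      qed
      have below: "Im u \<le> Im w" if "cpoly P u = 0" for u
      proof (cases "Im u = 0")
        case False
        then have "u \<in> X" using that by (simp add: X_def)
        then obtain \<zeta> where \<zeta>: "\<zeta> \<in> Z" "u = \<sigma> \<zeta>" using \<sigma>(1) by (auto simp: bij_betw_def)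
        have "Im u \<le> cmod (u - \<zeta>) + cmod \<zeta>"
          using norm_triangle_sub[of u \<zeta>] abs_Im_le_cmod[of u] by linarith
        then show ?thesis using \<sigma>(2)[OF \<zeta>(1)] \<zeta> T(2)[OF \<zeta>(1)] \<epsilon>(4) w by simp
      qed (use w T in simp)
      have "(\<Sum>t\<in>R. 1 / (cmod (w - of_real t))\<^sup>2) \<le> cmod (cpoly (pderiv P) w / cpoly P w)"
        using w T by (intro sum_real_roots_bound[OF P0 degP Pw _ below]) (auto simp: R_def)
      also have "\<dots> \<le> \<eta> / L * real N"
      proof -
        have "cmod (cpoly (pderiv P) w / cpoly P w) / real N < \<eta> / L"
          using Pw' unfolding norm_divide[of _ "of_nat N"] norm_of_nat .
        moreover have "a \<le> b * real N" if "a / real N < b" for a b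
          using that N(2) by (simp add: pos_divide_less_eq)
        ultimately show ?thesis by blast
      qed
      finally have w_sum: "(\<Sum>i<n. 1 / (cmod (w - of_real (x i)))\<^sup>2) \<le> \<eta> / L * real N"
        using sum.reindex_bij_betw[OF xR, of "\<lambda>t. 1 / (cmod (w - of_real t))\<^sup>2"] by simp
      have reg_sum: "(\<Sum>i<n. 1 / (cmod (z k - of_real (x i)))\<^sup>2) \<le> \<eta> * real N" if k: "k < m" for k
      proof -
        obtain \<zeta> where \<zeta>: "\<zeta> \<in> Z" "z k = \<sigma> \<zeta>" using z_near[OF k] by blast
        have Q: "cmod (w - z k) \<le> Q"
          using norm_triangle_ineq4[of w "z k"] norm_triangle_sub[of "z k" \<zeta>] 
            \<sigma>(2)[OF \<zeta>(1), folded \<zeta>(2)] T(2)[OF \<zeta>(1)] \<epsilon>(4)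
          unfolding Q_def by linarith
        have "(\<Sum>i<n. 1 / (cmod (z k - of_real (x i)))\<^sup>2) \<le> (\<Sum>i<n. L * (1 / (cmod (w - of_real (x i)))\<^sup>2))"
          unfolding L_def
        proof (intro sum_mono inverse_square_compare)
          fix i
          show "\<rho> \<le> cmod (z k - of_real (x i))"
            using off_real[OF Im_\<sigma>[OF \<zeta>(1)], of "x i"] \<zeta>(2) by (simp add: norm_minus_commute)
          show "w \<noteq> of_real (x i)" using wim by (metis Im_complex_of_real)
        qed (use \<rho> Q in auto)
        also have "\<dots> = L * (\<Sum>i<n. 1 / (cmod (w - of_real (x i)))\<^sup>2)" by (simp add: sum_distrib_left)
        also have "\<dots> \<le> L * (\<eta> / L * real N)" using w_sum L by (intro mult_left_mono) auto
        also have "\<dots> = \<eta> * real N" using L by simp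
        finally show ?thesis .
      qed
      have reg_curv: "1 / 2 \<le> Re (curv ?H (of_real t) + (\<Sum>k<m. 1 / (of_real t - z k)\<^sup>2))" for t
      proof -
        have "cpoly (hermite_wr \<nu>) (of_real t) \<noteq> 0" using hermite_wr_pos[of \<nu> t] by (simp add:
            cpoly_of_real)
        then have eq: "curv ?H (of_real t) + (\<Sum>k<m. 1 / (of_real t - z k)\<^sup>2) =
           1 - (\<Sum>\<zeta>\<in>Z. 1 / (of_real t - \<zeta>)\<^sup>2 - 1 / (of_real t - \<sigma> \<zeta>)\<^sup>2)"
          unfolding curv_smult[OF c] sum_z[of "\<lambda>u. 1 / (of_real t - u)\<^sup>2"]
          by (simp add: curv_hermite_wr Z_def sum_subtractf)
        have "cmod (\<Sum>\<zeta>\<in>Z. 1 / (of_real t - \<zeta>)\<^sup>2 - 1 / (of_real t - \<sigma> \<zeta>)\<^sup>2) \<le> (\<Sum>\<zeta>\<in>Z. 2 * \<epsilon> / \<rho> ^ 3)"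
        proof (intro sum_norm_le inverse_square_close)
          fix \<zeta> assume \<zeta>: "\<zeta> \<in> Z"
          show "\<rho> \<le> cmod (of_real t - \<zeta>)" using \<rho>(1) \<rho>(2)[OF \<zeta>] by (intro off_real) simp
          show "\<rho> \<le> cmod (of_real t - \<sigma> \<zeta>)" by (rule off_real[OF Im_\<sigma>[OF \<zeta>]])
          show "cmod (of_real t - \<zeta> - (of_real t - \<sigma> \<zeta>)) \<le> \<epsilon>" using \<sigma>(2)[OF \<zeta>] by simp
        qed (rule \<rho>(1))
        also have "\<dots> = real m * (2 * \<epsilon> / \<rho> ^ 3)" using Z by simp
        also have "\<dots> \<le> 1 / 2" using \<epsilon>(5) m \<rho>(1) by (simp add: divide_simps mult.commute)
        finally have "Re (\<Sum>\<zeta>\<in>Z. 1 / (of_real t - \<zeta>)\<^sup>2 - 1 / (of_real t - \<sigma> \<zeta>)\<^sup>2) \<le> 1 / 2"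
          using complex_Re_le_cmod order.trans by blast
        then show ?thesis unfolding eq by (simp del: Re_sum)
      qed
      have reg_dom: "2 / K * (\<Sum>k<m. 1 / (cmod (of_real t - z k))\<^sup>2) \<le> 1 / 2" for t
      proof -
        have "(\<Sum>\<zeta>\<in>Z. 1 / (cmod (of_real t - \<sigma> \<zeta>))\<^sup>2) \<le> (\<Sum>\<zeta>\<in>Z. 1 / \<rho>\<^sup>2)"
        proof (rule sum_mono)
          fix \<zeta> assume "\<zeta> \<in> Z"
          then have le: "\<rho> \<le> cmod (of_real t - \<sigma> \<zeta>)" by (intro off_real Im_\<sigma>)
          then have "\<rho>\<^sup>2 \<le> (cmod (of_real t - \<sigma> \<zeta>))\<^sup>2" using \<rho>(1) by (intro power_mono) auto
          then show "1 / (cmod (of_real t - \<sigma> \<zeta>))\<^sup>2 \<le> 1 / \<rho>\<^sup>2"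
            using \<rho>(1) le by (intro divide_left_mono mult_pos_pos) auto
        qed
        then have "2 / K * (\<Sum>k<m. 1 / (cmod (of_real t - z k))\<^sup>2) \<le> 2 / K * (real m / \<rho>\<^sup>2)"
          using K Z unfolding sum_z[of "\<lambda>u. 1 / (cmod (of_real t - u))\<^sup>2"] by (intro mult_left_mono) auto
        also have "\<dots> = 1 / 2" using m \<rho>(1) by (simp add: K_def)
        finally show ?thesis .
      qed
      have small: "8 * S + (8 + 2 * K) * (\<eta> * real N) < 4 * real N"
        using N \<eta>(2) by (simp add: mult.assoc[symmetric])
      have pos: "0 < Re (curv ?H (of_real t) + (\<Sum>k<m. 1 / (of_real t - z k)\<^sup>2))" for t
        using reg_curv[of t] by linarith
      have dom: "2 / K * (\<Sum>k<m. 1 / (cmod (of_real t - z k))\<^sup>2) \<le>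
          Re (curv ?H (of_real t) + (\<Sum>k<m. 1 / (of_real t - z k)\<^sup>2))" for t
        using reg_curv[of t] reg_dom[of t] by linarith
      show "let A = hessian (2 * m + n) (log_energy ?H m n) (coords m z x)
        in diagonally_dominant (modified_hessian m n K A) \<and>
          (\<forall>i<n. A $$ (2 * m + i, 2 * m + i) < 0) \<and>
          (\<forall>l<m. A $$ (2 * l, 2 * l) = - (A $$ (2 * l + 1, 2 * l + 1)) \<and> A $$ (2 * l, 2 * l) < 0)"
        unfolding Let_def
        using N(2) \<eta>(1)
        by (intro dominance[OF adm K _ _ small curv_z exc_sum reg_sum pos dom]) auto
    qed
  qed
  with K show ?thesis by blast
qed

theorem theorem3:
  fixes h :: "nat \<Rightarrow> real poly" and \<nu> :: nat
  assumes "orthonormal_hermite h" and "\<nu> \<ge> 1"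
  shows "\<exists>K>0. \<exists>n\<^sub>0. \<forall>n\<ge>n\<^sub>0. \<forall>z x.
    (let m = 2 * \<nu>;
         H = wronskian [h \<nu>, h (\<nu> + 1)];
         P = wronskian [hermite \<nu>, hermite (\<nu> + 1), hermite (n + 2)];
         Hs = hessian (2 * m + n) (log_energy H m n) (coords m z x)
     in bij_betw z {..<m} {u. cpoly P u = 0 \<and> Im u \<noteq> 0} \<longrightarrow>
        bij_betw x {..<n} {t. poly P t = 0} \<longrightarrow>
        diagonally_dominant (modified_hessian m n K Hs) \<and>
        (\<forall>i<n. Hs $$ (2 * m + i, 2 * m + i) < 0) \<and>
        (\<forall>l<m. Hs $$ (2 * l, 2 * l) = - (Hs $$ (2 * l + 1, 2 * l + 1)) \<and>
                Hs $$ (2 * l, 2 * l) < 0))"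
proof -
  obtain c where c: "c > 0" "wronskian [h \<nu>, h (\<nu> + 1)] = Polynomial.smult c (hermite_wr \<nu>)"
    using wronskian_orthonormal_hermite[OF assms(1), of \<nu>] by auto
  have e: "wronskian [hermite \<nu>, hermite (\<nu> + 1), hermite (n + 2)] = exc \<nu> (n + 2)" for n
    by (simp add: exc_def del: hermite.simps)
  show ?thesis
    using exc_dominance[OF assms(2), of c] c(1)
    unfolding c(2) e Let_def eventually_sequentially by simp
qed

end
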